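(* Let $Y=\mathbb{P}^{n_1}\times\dots\times\mathbb{P}^{n_k}$ and let $E\sqcup F=\{1,\dots,k\}$ be a partition, with $E=\{a_1,\dots,a_{k-h}\}$ and $F=\{b_1,\dots,b_h\}$ for some fixed $0<h<k$. Let $M_F:=\prod_{i=1}^{h}(n_{b_i}+1)$ (the affine dimension of the ambient space of the Segre embedding of $Y_F:=\mathbb{P}^{n_{b_1}}\times\dots\times\mathbb{P}^{n_{b_h}}$). Fix an integer $0<c<M_F$ and let $A\subset Y$ be a zero-dimensional scheme which satisfies $h^1(\mathcal{I}_A(E))=0$ and $h^0(\mathcal{I}_A(F))<M_F-c$. Take any $T\in\langle\nu(A)\rangle$ such that $T\notin\langle\nu(A')\rangle$ for any $A'\subsetneq A$. Then there are no zero-dimensional schemes $B\subset Y$ with $\deg(B)\le c$ such that $T\in\langle\nu(B)\rangle$.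
   Context: The base field is $\mathbb{C}$. $\nu:Y\to\mathbb{P}^M$, $M=-1+\prod_{i=1}^k(n_i+1)$, is the Segre embedding. For a subscheme $Z$ of a projective space, $\langle Z\rangle$ is its linear span. $\deg$ of a zero-dimensional scheme is its length. For $\mathbf{u}\subset\{1,\dots,k\}$, $\pi_{\mathbf{u}}$ is the projection of $Y$ to the product of the factors with index in $\mathbf{u}$, and $\mathcal{O}(\mathbf{u})$ is the line bundle on $Y$ obtained as the pull-back via $\pi_{\mathbf{u}}$ of the hyperplane bundle of the Segre embedding of $\pi_{\mathbf{u}}(Y)$ (i.e. multidegree $1$ on the factors in $\mathbf{u}$ and $0$ on the others). For a subscheme $Z\subset Y$ with ideal sheaf $\mathcal{I}_Z\subset\mathcal{O}_Y$, $\mathcal{I}_Z(\mathbf{u})=\mathcal{I}_Z\otimes\mathcal{O}(\mathbf{u})$, and $h^i(\mathcal{I}_Z(\mathbf{u}))=\dim H^i(Y,\mathcal{I}_Z(\mathbf{u}))$. *)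

theory Defs
  imports
    "HOL-Algebra.Ideal"
    "HOL-Library.Poly_Mapping"
    "HOL-Library.Extended_Nat"
    "HOL-Library.FuncSet"
    "HOL-Library.Indicator_Function"
    Complex_Main
begin

text \<open>
  Conventions.  \<open>Y\<close> is the product of the projective spaces of dimension \<open>n i\<close>, for
  \<open>i \<in> {1..k}\<close>, over the complex numbers; the \<open>i\<close>-th factor has homogeneous coordinates
  \<open>x(i,0), \<dots>, x(i,n i)\<close>.  Everything takes place in the ring of Laurent polynomials in the
  variables \<open>x(i,j)\<close>: a Laurent monomial is an exponent vector, and sections of a line bundle
  over any intersection of standard affine charts of \<open>Y\<close> are Laurent polynomials.
\<close>

type_synonym exponent = "(nat \<times> nat) \<Rightarrow>\<^sub>0 int"
type_synonym laurent = "exponent \<Rightarrow>\<^sub>0 complex"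

definition cox_vars :: "nat \<Rightarrow> (nat \<Rightarrow> nat) \<Rightarrow> (nat \<times> nat) set" where
  "cox_vars k n = Sigma {1..k} (\<lambda>i. {0..n i})"

definition multidegree :: "(nat \<Rightarrow> nat) \<Rightarrow> exponent \<Rightarrow> nat \<Rightarrow> int" where
  "multidegree n m i = (\<Sum>j = 0..n i. Poly_Mapping.lookup m (i, j))"

text \<open>
  A choice \<open>\<sigma>\<close> of one coordinate in each factor.  It indexes the standard affine chart
  \<open>U(\<sigma>)\<close>, where \<open>x(i, \<sigma> i) \<noteq> 0\<close> for all \<open>i\<close>, and also the homogeneous coordinate
  \<open>z(\<sigma>)\<close> of the target of the Segre embedding.
\<close>

definition multi_indices :: "nat \<Rightarrow> (nat \<Rightarrow> nat) \<Rightarrow> (nat \<Rightarrow> nat) set" where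
  "multi_indices k n = (\<Pi>\<^sub>E i \<in> {1..k}. {0..n i})"

text \<open>
  The sections of the line bundle of multidegree \<open>d\<close> over \<open>U(\<tau>)\<close>, the intersection of the
  charts \<open>U(\<sigma>)\<close> with \<open>\<sigma> \<in> \<tau>\<close>: the Laurent polynomials, homogeneous of multidegree \<open>d\<close>, in
  which only variables that are invertible on \<open>U(\<tau>)\<close> have negative exponents.
\<close>

definition line_bundle_sections ::
  "nat \<Rightarrow> (nat \<Rightarrow> nat) \<Rightarrow> (nat \<Rightarrow> int) \<Rightarrow> (nat \<Rightarrow> nat) set \<Rightarrow> laurent set" where
  "line_bundle_sections k n d \<tau> =
    {f. \<forall>m \<in> Poly_Mapping.keys f.
          Poly_Mapping.keys m \<subseteq> cox_vars k n \<and>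
          (\<forall>i \<in> {1..k}. multidegree n m i = d i) \<and>
          (\<forall>i j. Poly_Mapping.lookup m (i, j) < 0 \<longrightarrow> (\<exists>\<sigma> \<in> \<tau>. j = \<sigma> i))}"

definition coord_ring :: "nat \<Rightarrow> (nat \<Rightarrow> nat) \<Rightarrow> (nat \<Rightarrow> nat) set \<Rightarrow> laurent ring" where
  "coord_ring k n \<tau> =
    \<lparr>carrier = line_bundle_sections k n (\<lambda>_. 0) \<tau>, monoid.mult = (*), one = 1,
     ring.zero = 0, add = (+)\<rparr>"

lemma line_bundle_sections_mult:
  assumes "f \<in> line_bundle_sections k n d \<tau>" and "g \<in> line_bundle_sections k n e \<tau>"
  shows "f * g \<in> line_bundle_sections k n (\<lambda>i. d i + e i) \<tau>"
  unfolding line_bundle_sections_def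
proof (intro CollectI ballI)
  fix m assume "m \<in> Poly_Mapping.keys (f * g)"
  then obtain a b where m: "m = a + b" and a: "a \<in> Poly_Mapping.keys f"
    and b: "b \<in> Poly_Mapping.keys g"
    using keys_mult[of f g] by blast
  have "Poly_Mapping.keys m \<subseteq> cox_vars k n"
    using assms a b keys_add[of a b] unfolding m line_bundle_sections_def by blast
  moreover have "\<forall>i\<in>{1..k}. multidegree n m i = d i + e i"
    using assms a b
    by (auto simp: m line_bundle_sections_def multidegree_def lookup_add sum.distrib)
  moreover have "\<forall>i j. Poly_Mapping.lookup m (i, j) < 0 \<longrightarrow> (\<exists>\<sigma>\<in>\<tau>. j = \<sigma> i)"
  proof (intro allI impI)
    fix i j assume "Poly_Mapping.lookup m (i, j) < 0"
    then have "Poly_Mapping.lookup a (i, j) < 0 \<or> Poly_Mapping.lookup b (i, j) < 0"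
      by (auto simp: m lookup_add)
    then show "\<exists>\<sigma>\<in>\<tau>. j = \<sigma> i"
      using assms a b unfolding line_bundle_sections_def by blast
  qed
  ultimately show "Poly_Mapping.keys m \<subseteq> cox_vars k n \<and>
      (\<forall>i\<in>{1..k}. multidegree n m i = d i + e i) \<and>
      (\<forall>i j. Poly_Mapping.lookup m (i, j) < 0 \<longrightarrow> (\<exists>\<sigma>\<in>\<tau>. j = \<sigma> i))"
    by blast
qed

lemma cring_coord_ring: "cring (coord_ring k n \<tau>)"
proof (rule cringI)
  let ?S = "line_bundle_sections k n (\<lambda>_. 0) \<tau>"
  have add: "f + g \<in> ?S" if "f \<in> ?S" "g \<in> ?S" for f g
    using that keys_add[of f g] unfolding line_bundle_sections_def by blast
  have uminus: "- f \<in> ?S" if "f \<in> ?S" for f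
    using that unfolding line_bundle_sections_def by simp
  have zero: "0 \<in> ?S" and one: "1 \<in> ?S"
    unfolding line_bundle_sections_def by (auto simp: multidegree_def)
  have mult: "f * g \<in> ?S" if "f \<in> ?S" "g \<in> ?S" for f g
    using line_bundle_sections_mult[OF that] by simp
  show "abelian_group (coord_ring k n \<tau>)"
  proof (rule abelian_groupI)
    fix f assume "f \<in> carrier (coord_ring k n \<tau>)"
    then show "\<exists>g\<in>carrier (coord_ring k n \<tau>). g \<oplus>\<^bsub>coord_ring k n \<tau>\<^esub> f = \<zero>\<^bsub>coord_ring k n \<tau>\<^esub>"
      using uminus by (intro bexI[of _ "- f"]) (auto simp: coord_ring_def)
  qed (auto simp: coord_ring_def add zero algebra_simps)
  show "Group.comm_monoid (coord_ring k n \<tau>)"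
    by (rule comm_monoidI) (auto simp: coord_ring_def mult one algebra_simps)
qed (auto simp: coord_ring_def algebra_simps)

text \<open>
  A closed subscheme is given by its quasi-coherent ideal sheaf, that is, by an ideal of the
  coordinate ring of each standard chart, such that the ideals of two charts generate the same
  ideal of the coordinate ring of their intersection.  Only the values at elements of
  \<open>multi_indices k n\<close> matter.
\<close>

type_synonym ideal_data = "(nat \<Rightarrow> nat) \<Rightarrow> laurent set"

definition closed_subscheme :: "nat \<Rightarrow> (nat \<Rightarrow> nat) \<Rightarrow> ideal_data \<Rightarrow> bool" where
  "closed_subscheme k n Z \<longleftrightarrow>
    (\<forall>\<sigma> \<in> multi_indices k n. ideal (Z \<sigma>) (coord_ring k n {\<sigma>})) \<and>
    (\<forall>\<sigma> \<in> multi_indices k n. \<forall>\<rho> \<in> multi_indices k n.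
       genideal (coord_ring k n {\<sigma>, \<rho>}) (Z \<sigma>) = genideal (coord_ring k n {\<sigma>, \<rho>}) (Z \<rho>))"

text \<open>The inclusion \<open>Z' \<subset> Z\<close> of subschemes reverses the inclusion of ideals.\<close>

definition proper_subscheme ::
  "nat \<Rightarrow> (nat \<Rightarrow> nat) \<Rightarrow> ideal_data \<Rightarrow> ideal_data \<Rightarrow> bool" where
  "proper_subscheme k n Z' Z \<longleftrightarrow>
    closed_subscheme k n Z' \<and>
    (\<forall>\<sigma> \<in> multi_indices k n. Z \<sigma> \<subseteq> Z' \<sigma>) \<and>
    (\<exists>\<sigma> \<in> multi_indices k n. Z \<sigma> \<noteq> Z' \<sigma>)"

text \<open>
  Dimension at most zero, in terms of Krull dimension: on each chart, every prime ideal
  containing the ideal of \<open>Z\<close> is maximal.  The empty scheme is allowed.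
\<close>

definition zero_dim_scheme :: "nat \<Rightarrow> (nat \<Rightarrow> nat) \<Rightarrow> ideal_data \<Rightarrow> bool" where
  "zero_dim_scheme k n Z \<longleftrightarrow>
    closed_subscheme k n Z \<and>
    (\<forall>\<sigma> \<in> multi_indices k n. \<forall>P.
       primeideal P (coord_ring k n {\<sigma>}) \<and> Z \<sigma> \<subseteq> P \<longrightarrow> maximalideal P (coord_ring k n {\<sigma>}))"

text \<open>
  The ideal of \<open>Z\<close> on \<open>U(\<tau>)\<close>, for nonempty \<open>\<tau>\<close>; by the gluing condition any single \<open>\<sigma> \<in> \<tau>\<close>
  already generates it.
\<close>

definition ideal_sections ::
  "nat \<Rightarrow> (nat \<Rightarrow> nat) \<Rightarrow> ideal_data \<Rightarrow> (nat \<Rightarrow> nat) set \<Rightarrow> laurent set" where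
  "ideal_sections k n Z \<tau> = genideal (coord_ring k n \<tau>) (\<Union>\<sigma> \<in> \<tau>. Z \<sigma>)"

text \<open>
  The sections over \<open>U(\<tau>)\<close> of the tensor product of the ideal sheaf of \<open>Z\<close> with the line
  bundle of multidegree \<open>d\<close>.  As a line bundle is flat, this is the image of the tensor
  product in the line bundle, which consists of the finite sums of products.
\<close>

definition twisted_ideal_sections ::
  "nat \<Rightarrow> (nat \<Rightarrow> nat) \<Rightarrow> ideal_data \<Rightarrow> (nat \<Rightarrow> int) \<Rightarrow> (nat \<Rightarrow> nat) set \<Rightarrow> laurent set" where
  "twisted_ideal_sections k n Z d \<tau> =
    {\<Sum>r<(N::nat). a r * b r | N a b.
       \<forall>r<N. a r \<in> ideal_sections k n Z \<tau> \<and> b r \<in> line_bundle_sections k n d \<tau>}"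

text \<open>
  The dimension, possibly infinite, of the complex vector space \<open>V / W\<close>, where \<open>V\<close> and \<open>W\<close>
  are spaces of families of Laurent polynomials: the supremum of the cardinalities of the
  finite subsets of \<open>V\<close> that are linearly independent modulo \<open>W\<close>.
\<close>

definition quotient_dim :: "('a \<Rightarrow> laurent) set \<Rightarrow> ('a \<Rightarrow> laurent) set \<Rightarrow> enat" where
  "quotient_dim V W =
    Sup {enat (card B) | B. finite B \<and> B \<subseteq> V \<and>
      (\<forall>a :: ('a \<Rightarrow> laurent) \<Rightarrow> complex.
         (\<lambda>x. \<Sum>f\<in>B. Poly_Mapping.single 0 (a f) * f x) \<in> W \<longrightarrow> (\<forall>f\<in>B. a f = 0))}"

text \<open>
  The degree (length) of \<open>Z\<close> is the dimension of the space of global sections of its structure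
  sheaf, the quotient of the structure sheaf of \<open>Y\<close> by the ideal sheaf: a global section is
  given by regular functions on the charts that agree modulo the ideal on overlaps, and it
  vanishes if these functions lie in the ideals of the charts.
\<close>

definition scheme_degree :: "nat \<Rightarrow> (nat \<Rightarrow> nat) \<Rightarrow> ideal_data \<Rightarrow> enat" where
  "scheme_degree k n Z =
    quotient_dim
      {f. (\<forall>\<sigma> \<in> multi_indices k n. f \<sigma> \<in> carrier (coord_ring k n {\<sigma>})) \<and>
          (\<forall>\<sigma> \<in> multi_indices k n. \<forall>\<rho> \<in> multi_indices k n.
             f \<sigma> - f \<rho> \<in> ideal_sections k n Z {\<sigma>, \<rho>})}
      {f. \<forall>\<sigma> \<in> multi_indices k n. f \<sigma> \<in> Z \<sigma>}"

text \<open>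
  Sheaf cohomology is defined as the Cech cohomology of the covering by the standard affine
  charts, all of whose finite intersections are affine.  A \<open>p\<close>-cochain assigns a section over
  the intersection of the charts to each \<open>(p + 1)\<close>-tuple of charts; its values on other lists
  are irrelevant.
\<close>

definition simplices :: "nat \<Rightarrow> (nat \<Rightarrow> nat) \<Rightarrow> nat \<Rightarrow> (nat \<Rightarrow> nat) list set" where
  "simplices k n p = {s. length s = p + 1 \<and> set s \<subseteq> multi_indices k n}"

definition cochains ::
  "nat \<Rightarrow> (nat \<Rightarrow> nat) \<Rightarrow> ideal_data \<Rightarrow> (nat \<Rightarrow> int) \<Rightarrow> nat \<Rightarrow> ((nat \<Rightarrow> nat) list \<Rightarrow> laurent) set" where
  "cochains k n Z d p =
    {c. \<forall>s \<in> simplices k n p. c s \<in> twisted_ideal_sections k n Z d (set s)}"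

definition cech_diff :: "((nat \<Rightarrow> nat) list \<Rightarrow> laurent) \<Rightarrow> (nat \<Rightarrow> nat) list \<Rightarrow> laurent" where
  "cech_diff c s = (\<Sum>j<length s. (-1) ^ j * c (take j s @ drop (Suc j) s))"

definition cocycles ::
  "nat \<Rightarrow> (nat \<Rightarrow> nat) \<Rightarrow> ideal_data \<Rightarrow> (nat \<Rightarrow> int) \<Rightarrow> nat \<Rightarrow> ((nat \<Rightarrow> nat) list \<Rightarrow> laurent) set" where
  "cocycles k n Z d p =
    {c \<in> cochains k n Z d p. \<forall>s \<in> simplices k n (p + 1). cech_diff c s = 0}"

definition coboundaries ::
  "nat \<Rightarrow> (nat \<Rightarrow> nat) \<Rightarrow> ideal_data \<Rightarrow> (nat \<Rightarrow> int) \<Rightarrow> nat \<Rightarrow> ((nat \<Rightarrow> nat) list \<Rightarrow> laurent) set" where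
  "coboundaries k n Z d p =
    (case p of
       0 \<Rightarrow> {c. \<forall>s \<in> simplices k n 0. c s = 0}
     | Suc q \<Rightarrow> {c. \<exists>b \<in> cochains k n Z d q. \<forall>s \<in> simplices k n p. c s = cech_diff b s})"

text \<open>
  The dimension of the \<open>p\<close>-th cohomology group of the ideal sheaf of \<open>Z\<close> twisted by the line
  bundle that has degree 1 on the factors in \<open>u\<close> and degree 0 on the others.
\<close>

definition h_ideal :: "nat \<Rightarrow> (nat \<Rightarrow> nat) \<Rightarrow> nat \<Rightarrow> ideal_data \<Rightarrow> nat set \<Rightarrow> enat" where
  "h_ideal k n p Z u =
    quotient_dim (cocycles k n Z (indicator u) p) (coboundaries k n Z (indicator u) p)"

text \<open>
  The Segre embedding is given by \<open>z(\<alpha>) = x(1, \<alpha> 1) * \<dots> * x(k, \<alpha> k)\<close>.  The function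
  \<open>segre_pullback\<close> sends the linear form with coefficients \<open>l\<close> in the coordinates \<open>z(\<alpha>)\<close> to
  the corresponding form of multidegree \<open>(1, \<dots>, 1)\<close> on \<open>Y\<close>.
\<close>

definition segre_monomial :: "nat \<Rightarrow> (nat \<Rightarrow> nat) \<Rightarrow> laurent" where
  "segre_monomial k \<alpha> = (\<Prod>i = 1..k. Poly_Mapping.single (Poly_Mapping.single (i, \<alpha> i) 1) 1)"

definition segre_pullback ::
  "nat \<Rightarrow> (nat \<Rightarrow> nat) \<Rightarrow> ((nat \<Rightarrow> nat) \<Rightarrow> complex) \<Rightarrow> laurent" where
  "segre_pullback k n l =
    (\<Sum>\<alpha> \<in> multi_indices k n. Poly_Mapping.single 0 (l \<alpha>) * segre_monomial k \<alpha>)"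

text \<open>
  The hyperplane with equation \<open>l\<close> contains the scheme \<open>\<nu>(Z)\<close> iff the pull-back of \<open>l\<close> is a
  section of the twisted ideal sheaf of \<open>Z\<close>.
\<close>

definition hyperplane_contains ::
  "nat \<Rightarrow> (nat \<Rightarrow> nat) \<Rightarrow> ((nat \<Rightarrow> nat) \<Rightarrow> complex) \<Rightarrow> ideal_data \<Rightarrow> bool" where
  "hyperplane_contains k n l Z \<longleftrightarrow>
    (\<forall>\<sigma> \<in> multi_indices k n.
       segre_pullback k n l \<in> twisted_ideal_sections k n Z (\<lambda>_. 1) {\<sigma>})"

text \<open>
  The linear span of \<open>\<nu>(Z)\<close>, the intersection of all hyperplanes containing \<open>\<nu>(Z)\<close>.  A point
  of the target projective space is given by homogeneous coordinates \<open>T \<alpha>\<close>, not all zero; the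
  values of \<open>T\<close> outside \<open>multi_indices k n\<close> are irrelevant.
\<close>

definition segre_span ::
  "nat \<Rightarrow> (nat \<Rightarrow> nat) \<Rightarrow> ideal_data \<Rightarrow> ((nat \<Rightarrow> nat) \<Rightarrow> complex) set" where
  "segre_span k n Z =
    {T. (\<exists>\<alpha> \<in> multi_indices k n. T \<alpha> \<noteq> 0) \<and>
        (\<forall>l. hyperplane_contains k n l Z \<longrightarrow> (\<Sum>\<alpha> \<in> multi_indices k n. l \<alpha> * T \<alpha>) = 0)}"

end

theory Submission
  imports Defs
begin

text \<open>
  Regard \<open>T\<close> as a linear functional on the forms of multidegree \<open>(1, \<dots>, 1)\<close>. It induces a
  pairing of the forms of multidegree \<open>E\<close> with those of multidegree \<open>F\<close>; let \<open>K\<close> be the space of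
  forms \<open>g\<close> of multidegree \<open>F\<close> that pair to zero with all forms of multidegree \<open>E\<close>.

  If \<open>T\<close> is in the span of \<open>B\<close>, then \<open>K\<close> contains all \<open>g\<close> that vanish on \<open>B\<close>, so its codimension
  is at most the degree of \<open>B\<close>, because line bundles on \<open>B\<close> are trivial.

  On the other hand every \<open>g\<close> in \<open>K\<close> vanishes on \<open>A\<close>. Otherwise let \<open>A'\<close> be the proper subscheme of
  \<open>A\<close> cut out by \<open>g\<close>. A form \<open>f\<close> of multidegree \<open>(1, \<dots>, 1)\<close> vanishing on \<open>A'\<close> is on \<open>A\<close> a multiple
  \<open>s g\<close> with a section \<open>s\<close> of \<open>O(E)\<close> over \<open>A\<close>, and \<open>s\<close> lifts to a form \<open>v\<close> of multidegree \<open>E\<close> as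
  \<open>h\<^sup>1\<close> vanishes; so \<open>T\<close> takes the same value on \<open>f\<close> as on \<open>v g\<close>, namely 0. Hence \<open>T\<close> is in
  the span of \<open>A'\<close>, contradicting minimality. So the codimension of \<open>K\<close> is greater than \<open>c\<close>.

  Both parts need that global functions on a zero-dimensional scheme separate its points. As a
  substitute for the decomposition into local Artinian schemes, the open subschemes cut out by
  the charts are shown to be closed, by idempotents obtained from \<open>\<pi>\<close>-regularity.
\<close>

section \<open>Ideals of subrings and sections of line bundles\<close>

text \<open>Subrings and their ideals are plain sets inside a ring type, so that identities can be
  proved in the type class; \<open>ideal_coord_ring_iff\<close> translates to the record-based
  ideals of the definitions. The choice J = S supplies the closure facts alone.\<close>

locale ring_ideal =
  fixes S J :: "'a::comm_ring_1 set"
  assumes one_closed: "1 \<in> S"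
    and add_closed: "\<And>a b. a \<in> S \<Longrightarrow> b \<in> S \<Longrightarrow> a + b \<in> S"
    and uminus_closed: "\<And>a. a \<in> S \<Longrightarrow> - a \<in> S"
    and mult_closed: "\<And>a b. a \<in> S \<Longrightarrow> b \<in> S \<Longrightarrow> a * b \<in> S"
    and subset: "J \<subseteq> S"
    and zero_mem: "0 \<in> J"
    and add_mem: "\<And>a b. a \<in> J \<Longrightarrow> b \<in> J \<Longrightarrow> a + b \<in> J"
    and mult_mem: "\<And>r a. r \<in> S \<Longrightarrow> a \<in> J \<Longrightarrow> r * a \<in> J"
begin

lemma mult_mem_right: "a \<in> J \<Longrightarrow> r \<in> S \<Longrightarrow> a * r \<in> J"
  using mult_mem[of r a] by (simp add: mult.commute)

lemma diff_closed: "a \<in> S \<Longrightarrow> b \<in> S \<Longrightarrow> a - b \<in> S"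
  using add_closed[of a "- b"] uminus_closed by simp

lemma uminus_mem: "a \<in> J \<Longrightarrow> - a \<in> J"
  using mult_mem[OF uminus_closed[OF one_closed]] by simp

lemma diff_mem: "a \<in> J \<Longrightarrow> b \<in> J \<Longrightarrow> a - b \<in> J"
  using add_mem[of a "- b"] uminus_mem by simp

lemma zero_closed: "0 \<in> S"
  using zero_mem subset by blast

lemma power_closed: "a \<in> S \<Longrightarrow> a ^ N \<in> S"
  by (induction N) (auto intro: one_closed mult_closed)

lemma sum_closed: "(\<And>i. i \<in> I \<Longrightarrow> f i \<in> S) \<Longrightarrow> sum f I \<in> S"
  by (induction I rule: infinite_finite_induct) (auto intro: zero_closed add_closed)

lemma prod_closed: "(\<And>i. i \<in> I \<Longrightarrow> f i \<in> S) \<Longrightarrow> prod f I \<in> S"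
  by (induction I rule: infinite_finite_induct) (auto intro: one_closed mult_closed)

lemma sum_mem: "(\<And>i. i \<in> I \<Longrightarrow> f i \<in> J) \<Longrightarrow> sum f I \<in> J"
  by (induction I rule: infinite_finite_induct) (auto intro: zero_mem add_mem)

lemma cong_mult:
  assumes "a - a' \<in> J" "b - b' \<in> J" "a' \<in> S" "b \<in> S"
  shows "a * b - a' * b' \<in> J"
proof -
  have "a * b - a' * b' = (a - a') * b + a' * (b - b')"
    by (simp add: algebra_simps)
  then show ?thesis
    using add_mem mult_mem mult_mem_right assms by metis
qed

lemma cong_prod:
  assumes "\<And>i. i \<in> I \<Longrightarrow> f i - g i \<in> J" "\<And>i. i \<in> I \<Longrightarrow> f i \<in> S" "\<And>i. i \<in> I \<Longrightarrow> g i \<in> S"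
  shows "prod f I - prod g I \<in> J"
  using assms
proof (induction I rule: infinite_finite_induct)
  case (insert i I)
  have "f i * prod f I - g i * prod g I \<in> J"
    by (rule cong_mult) (use insert in \<open>auto intro: prod_closed\<close>)
  then show ?case using insert by simp
qed (auto intro: zero_mem)

lemma power_diff_dvd:
  assumes "b \<in> S" "c \<in> S"
  obtains z where "z \<in> S" "b ^ N - c ^ N = (b - c) * z"
proof
  show "(\<Sum>i<N. c ^ (N - Suc i) * b ^ i) \<in> S"
    using assms by (auto intro!: sum_closed mult_closed power_closed)
  show "b ^ N - c ^ N = (b - c) * (\<Sum>i<N. c ^ (N - Suc i) * b ^ i)"
    by (rule power_diff_sumr2)
qed

text \<open>The hypothesis says that \<open>t\<close> is strongly \<open>\<pi>\<close>-regular modulo \<open>J\<close>: for \<open>N \<ge> M\<close> the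
  element \<open>(b * t) ^ N\<close> is an idempotent modulo \<open>J\<close> that cuts out the locus where \<open>t\<close> is
  invertible.\<close>

lemma pi_regular_mono:
  assumes "t ^ M * (b * t - 1) \<in> J" "t \<in> S" "M \<le> K"
  shows "t ^ K * (b * t - 1) \<in> J"
proof -
  have "t ^ K * (b * t - 1) = t ^ (K - M) * (t ^ M * (b * t - 1))"
    using assms(3) by (simp flip: power_add mult.assoc)
  then show ?thesis using assms mult_mem power_closed by metis
qed

text \<open>\<open>1 - (b * t) ^ N\<close> is a multiple of \<open>b * t - 1\<close>, which
  \<open>t ^ K\<close> carries into J. So the idempotent is 1 where t is invertible.\<close>

lemma pi_regular_power:
  assumes "t ^ M * (b * t - 1) \<in> J" "t \<in> S" "b \<in> S" "M \<le> K"
  shows "t ^ K * (1 - (b * t) ^ N) \<in> J"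
proof -
  obtain z where z: "z \<in> S" "(b * t) ^ N - 1 ^ N = (b * t - 1) * z"
    using power_diff_dvd[of "b * t" 1] assms mult_closed one_closed by metis
  have "t ^ K * (1 - (b * t) ^ N) = - (t ^ K * ((b * t) ^ N - 1 ^ N))"
    by (simp add: algebra_simps)
  also have "\<dots> = - (t ^ K * (b * t - 1) * z)"
    unfolding z by (simp add: mult.assoc)
  finally show ?thesis
    using z uminus_mem mult_mem_right pi_regular_mono[OF assms(1,2,4)] by metis
qed

text \<open>Modulo J, \<open>t ^ K * b\<close> and \<open>t ^ K * c\<close> both equal
  \<open>t ^ K * b * c * t\<close>. This compares quasi-inverses of t that were chosen independently
  on different charts.\<close>

lemma pi_regular_unique:
  assumes b: "t ^ M * (b * t - 1) \<in> J" "b \<in> S"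
    and c: "t ^ M * (c * t - 1) \<in> J" "c \<in> S"
    and "t \<in> S" "M \<le> K"
  shows "t ^ K * b ^ N - t ^ K * c ^ N \<in> J"
proof -
  obtain z where z: "z \<in> S" "b ^ N - c ^ N = (b - c) * z"
    using power_diff_dvd b c by metis
  have "t ^ K * b ^ N - t ^ K * c ^ N = t ^ K * (b ^ N - c ^ N)"
    by (simp add: algebra_simps)
  also have "\<dots> = (t ^ K * (b * t - 1) * c - t ^ K * (c * t - 1) * b) * z"
    unfolding z by (simp add: algebra_simps)
  finally show ?thesis
    using z b c assms(5,6) by (metis mult_mem_right diff_mem pi_regular_mono)
qed

end

text \<open>Telescoping: each summand is the product of the first j complements minus the product of
  the first j + 1. It is the total of idempotents made orthogonal one after another.\<close>

lemma sum_prod_complement: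
  fixes e :: "nat \<Rightarrow> 'a::comm_ring_1"
  shows "(\<Sum>j<m. e j * (\<Prod>i<j. 1 - e i)) = 1 - (\<Prod>i<m. 1 - e i)"
  by (induction m) (auto simp: algebra_simps)

section \<open>Coordinate monomials\<close>

definition coord_exponent :: "nat \<Rightarrow> (nat \<Rightarrow> int) \<Rightarrow> (nat \<Rightarrow> nat) \<Rightarrow> exponent" where
  "coord_exponent k d \<sigma> = (\<Sum>i = 1..k. Poly_Mapping.single (i, \<sigma> i) (d i))"

lemma lookup_coord_exponent:
  "Poly_Mapping.lookup (coord_exponent k d \<sigma>) (i, j) = (if i \<in> {1..k} \<and> j = \<sigma> i then d i else 0)"
proof -
  have "Poly_Mapping.lookup (coord_exponent k d \<sigma>) (i, j) =
      (\<Sum>i'=1..k. if i' = i then (if j = \<sigma> i then d i else 0) else 0)"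
    unfolding coord_exponent_def lookup_sum by (intro sum.cong) (auto simp: lookup_single when_def)
  also have "\<dots> = (if i \<in> {1..k} \<and> j = \<sigma> i then d i else 0)"
    by (subst sum.delta) auto
  finally show ?thesis .
qed

lemma multidegree_coord_exponent:
  assumes "i \<in> {1..k}" "d i \<noteq> 0 \<Longrightarrow> \<sigma> i \<le> n i"
  shows "multidegree n (coord_exponent k d \<sigma>) i = d i"
proof -
  have "multidegree n (coord_exponent k d \<sigma>) i = (\<Sum>j=0..n i. if j = \<sigma> i then d i else 0)"
    using assms(1) by (auto simp: multidegree_def lookup_coord_exponent intro!: sum.cong)
  then show ?thesis using assms(2) by auto
qed

text \<open>On the chart \<open>U(\<sigma>)\<close> this monomial is a nowhere vanishing generator
  of the line bundle of multidegree d; multiplication by its inverse turns sections into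
  functions.\<close>

definition coord_monomial :: "nat \<Rightarrow> (nat \<Rightarrow> int) \<Rightarrow> (nat \<Rightarrow> nat) \<Rightarrow> laurent" where
  "coord_monomial k d \<sigma> = Poly_Mapping.single (coord_exponent k d \<sigma>) 1"

lemma coord_monomial_mult:
  "coord_monomial k d \<sigma> * coord_monomial k e \<sigma> = coord_monomial k (\<lambda>i. d i + e i) \<sigma>"
  by (simp add: coord_monomial_def mult_single coord_exponent_def single_add sum.distrib)

lemma coord_monomial_cong:
  "(\<And>i. i \<in> {1..k} \<Longrightarrow> d i = e i) \<Longrightarrow> coord_monomial k d \<sigma> = coord_monomial k e \<sigma>"
  by (simp add: coord_monomial_def coord_exponent_def)

lemma coord_monomial_0: "coord_monomial k (\<lambda>_. 0) \<sigma> = 1"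
  by (simp add: coord_monomial_def coord_exponent_def)

lemma coord_monomial_inverse:
  "coord_monomial k d \<sigma> * coord_monomial k (\<lambda>i. - d i) \<sigma> = 1"
  "coord_monomial k (\<lambda>i. - d i) \<sigma> * coord_monomial k d \<sigma> = 1"
  by (simp_all add: coord_monomial_mult coord_monomial_0)

lemma coord_monomial_power:
  "coord_monomial k d \<sigma> ^ N = coord_monomial k (\<lambda>i. int N * d i) \<sigma>"
  by (induction N) (simp_all add: coord_monomial_0 coord_monomial_mult algebra_simps)

section \<open>Sections of line bundles over intersections of charts\<close>

lemma line_bundle_sections_cong:
  "(\<And>i. i \<in> {1..k} \<Longrightarrow> d i = e i) \<Longrightarrow> line_bundle_sections k n d \<tau> = line_bundle_sections k n e \<tau>"
  unfolding line_bundle_sections_def by auto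

lemma line_bundle_sections_mono:
  "\<tau> \<subseteq> \<tau>' \<Longrightarrow> line_bundle_sections k n d \<tau> \<subseteq> line_bundle_sections k n d \<tau>'"
  unfolding line_bundle_sections_def by fast

lemma line_bundle_sections_mono_mem:
  "f \<in> line_bundle_sections k n d \<tau> \<Longrightarrow> \<tau> \<subseteq> \<tau>' \<Longrightarrow> f \<in> line_bundle_sections k n d \<tau>'"
  using line_bundle_sections_mono by blast

lemma line_bundle_sections_mult':
  assumes "f \<in> line_bundle_sections k n d \<tau>" "g \<in> line_bundle_sections k n e \<tau>"
    "\<And>i. i \<in> {1..k} \<Longrightarrow> d i + e i = d' i"
  shows "f * g \<in> line_bundle_sections k n d' \<tau>"
  using line_bundle_sections_mult[OF assms(1,2)]
    line_bundle_sections_cong[of k "\<lambda>i. d i + e i" d' n \<tau>] assms(3) by blast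

lemma line_bundle_sections_add:
  "f \<in> line_bundle_sections k n d \<tau> \<Longrightarrow> g \<in> line_bundle_sections k n d \<tau> \<Longrightarrow>
    f + g \<in> line_bundle_sections k n d \<tau>"
  using keys_add[of f g] unfolding line_bundle_sections_def by blast

lemma line_bundle_sections_uminus:
  "f \<in> line_bundle_sections k n d \<tau> \<Longrightarrow> - f \<in> line_bundle_sections k n d \<tau>"
  unfolding line_bundle_sections_def by simp

lemma line_bundle_sections_diff:
  "f \<in> line_bundle_sections k n d \<tau> \<Longrightarrow> g \<in> line_bundle_sections k n d \<tau> \<Longrightarrow>
    f - g \<in> line_bundle_sections k n d \<tau>"
  using line_bundle_sections_add[of f k n d \<tau> "- g"] line_bundle_sections_uminus by auto

lemma line_bundle_sections_0: "0 \<in> line_bundle_sections k n d \<tau>"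
  unfolding line_bundle_sections_def by simp

lemma line_bundle_sections_sum:
  "(\<And>i. i \<in> I \<Longrightarrow> f i \<in> line_bundle_sections k n d \<tau>) \<Longrightarrow> sum f I \<in> line_bundle_sections k n d \<tau>"
  by (induction I rule: infinite_finite_induct)
    (auto intro: line_bundle_sections_0 line_bundle_sections_add)

lemma const_mem_line_bundle_sections:
  "Poly_Mapping.single 0 a \<in> line_bundle_sections k n (\<lambda>_. 0) \<tau>"
  unfolding line_bundle_sections_def by (auto simp: multidegree_def)

lemma one_mem_line_bundle_sections: "1 \<in> line_bundle_sections k n (\<lambda>_. 0) \<tau>"
  using const_mem_line_bundle_sections[of 1] by simp

text \<open>Where d is 0 the value of \<sigma> does not enter the monomial, so for a multidegree
  supported on F the index may be undefined on the other factors.\<close>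

lemma coord_monomial_mem:
  assumes "\<And>i. i \<in> {1..k} \<Longrightarrow> d i \<noteq> 0 \<Longrightarrow> \<sigma> i \<le> n i"
    and "\<sigma> \<in> \<tau> \<or> (\<forall>i\<in>{1..k}. 0 \<le> d i)"
  shows "coord_monomial k d \<sigma> \<in> line_bundle_sections k n d \<tau>"
proof -
  have "Poly_Mapping.keys (coord_exponent k d \<sigma>) \<subseteq> cox_vars k n"
  proof
    fix p assume p: "p \<in> Poly_Mapping.keys (coord_exponent k d \<sigma>)"
    obtain i j where [simp]: "p = (i, j)" by fastforce
    from p have "Poly_Mapping.lookup (coord_exponent k d \<sigma>) (i, j) \<noteq> 0"
      by (simp add: in_keys_iff)
    then show "p \<in> cox_vars k n"
      using assms(1)[of i] by (auto simp: lookup_coord_exponent cox_vars_def split: if_splits)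
  qed
  moreover have "\<exists>\<sigma>'\<in>\<tau>. j = \<sigma>' i" if "Poly_Mapping.lookup (coord_exponent k d \<sigma>) (i, j) < 0" for i j
  proof -
    have "i \<in> {1..k}" "j = \<sigma> i" "d i < 0"
      using that by (simp_all add: lookup_coord_exponent split: if_splits)
    then show ?thesis using assms(2) by fastforce
  qed
  ultimately show ?thesis
    using assms(1) by (simp add: coord_monomial_def line_bundle_sections_def multidegree_coord_exponent)
qed

lemma multi_indices_le: "\<sigma> \<in> multi_indices k n \<Longrightarrow> i \<in> {1..k} \<Longrightarrow> \<sigma> i \<le> n i"
  by (auto simp: multi_indices_def PiE_def Pi_def)

lemma finite_multi_indices: "finite (multi_indices k n)"
  unfolding multi_indices_def by (rule finite_PiE) auto

lemma multi_indices_nonempty: "multi_indices k n \<noteq> {}"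
  by (simp add: multi_indices_def PiE_eq_empty_iff)

lemma coord_monomial_mem_chart:
  "\<sigma> \<in> multi_indices k n \<Longrightarrow> \<sigma> \<in> \<tau> \<Longrightarrow> coord_monomial k d \<sigma> \<in> line_bundle_sections k n d \<tau>"
  by (rule coord_monomial_mem) (blast intro: multi_indices_le)+

lemma line_bundle_sectionsD:
  assumes "f \<in> line_bundle_sections k n d \<tau>" "m \<in> Poly_Mapping.keys f"
  shows "Poly_Mapping.keys m \<subseteq> cox_vars k n"
    and "i \<in> {1..k} \<Longrightarrow> multidegree n m i = d i"
    and "Poly_Mapping.lookup m (i, j) < 0 \<Longrightarrow> \<exists>\<sigma>\<in>\<tau>. j = \<sigma> i"
  using assms unfolding line_bundle_sections_def by blast+

text \<open>A negative exponent of \<open>x(i,j)\<close> forces \<open>j = \<sigma> i\<close> for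
  every chart, yet a chart with another index in factor i exists unless that factor is a point. In
  the latter case the exponent is the degree \<open>d i\<close> itself, which is
  nonnegative.\<close>

lemma line_bundle_sections_global:
  assumes f: "\<And>\<sigma>. \<sigma> \<in> multi_indices k n \<Longrightarrow> f \<in> line_bundle_sections k n d {\<sigma>}"
    and d: "\<And>i. i \<in> {1..k} \<Longrightarrow> 0 \<le> d i"
  shows "f \<in> line_bundle_sections k n d {}"
proof -
  obtain \<sigma>0 where \<sigma>0: "\<sigma>0 \<in> multi_indices k n"
    using multi_indices_nonempty by blast
  have False if m: "m \<in> Poly_Mapping.keys f" and neg: "Poly_Mapping.lookup m (i, j) < 0" for m i j
  proof -
    have "(i, j) \<in> Poly_Mapping.keys m" using neg by (simp add: in_keys_iff)
    then have ij: "i \<in> {1..k}" "j \<le> n i"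
      using line_bundle_sectionsD(1)[OF f[OF \<sigma>0] m] unfolding cox_vars_def by auto
    have eq: "j = \<sigma> i" if "\<sigma> \<in> multi_indices k n" for \<sigma>
      using line_bundle_sectionsD(3)[OF f[OF that] m neg] by simp
    have "n i = 0"
    proof (rule ccontr)
      assume "n i \<noteq> 0"
      define j' where "j' = (if j = 0 then 1 else 0 :: nat)"
      have "j' \<le> n i" "j \<noteq> j'" using \<open>n i \<noteq> 0\<close> by (simp_all add: j'_def)
      have "\<sigma>0(i := j') \<in> multi_indices k n"
        unfolding multi_indices_def
        using PiE_fun_upd[of j' "\<lambda>i. {0..n i}" i \<sigma>0 "{1..k}"] \<sigma>0 \<open>j' \<le> n i\<close> insert_absorb[OF ij(1)]
        by (simp add: multi_indices_def)
      from eq[OF this] \<open>j \<noteq> j'\<close> show False by simp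
    qed
    then have "multidegree n m i = Poly_Mapping.lookup m (i, j)"
      using ij by (simp add: multidegree_def)
    then show False
      using line_bundle_sectionsD(2)[OF f[OF \<sigma>0] m ij(1)] neg d[OF ij(1)] by simp
  qed
  then show ?thesis
    using f[OF \<sigma>0] unfolding line_bundle_sections_def by blast
qed

text \<open>The product of the fractions \<open>x(i, \<sigma> i) / x(i, \<rho> i)\<close>. It is a
  function on \<open>U(\<rho>)\<close>, and the overlap with \<open>U(\<sigma>)\<close> is the locus
  where it is invertible.\<close>

definition transition :: "nat \<Rightarrow> (nat \<Rightarrow> nat) \<Rightarrow> (nat \<Rightarrow> nat) \<Rightarrow> laurent" where
  "transition k \<sigma> \<rho> = coord_monomial k (\<lambda>_. 1) \<sigma> * coord_monomial k (\<lambda>_. - 1) \<rho>"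

lemma transition_self: "transition k \<sigma> \<sigma> = 1"
  using coord_monomial_inverse(1)[of k "\<lambda>_. 1"] by (simp add: transition_def)

lemma transition_mult: "transition k \<sigma> \<rho> * transition k \<rho> \<rho>' = transition k \<sigma> \<rho>'"
proof -
  have "transition k \<sigma> \<rho> * transition k \<rho> \<rho>' = coord_monomial k (\<lambda>_. 1) \<sigma> *
      (coord_monomial k (\<lambda>_. 1) \<rho> * coord_monomial k (\<lambda>_. - 1) \<rho>) * coord_monomial k (\<lambda>_. - 1) \<rho>'"
    by (simp only: transition_def mult_ac)
  then show ?thesis
    using coord_monomial_inverse(1)[of k "\<lambda>_. 1" \<rho>] by (simp add: transition_def)
qed

lemma transition_mem:
  assumes "\<sigma> \<in> multi_indices k n" "\<rho> \<in> multi_indices k n" "\<rho> \<in> \<tau>"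
  shows "transition k \<sigma> \<rho> \<in> line_bundle_sections k n (\<lambda>_. 0) \<tau>"
  unfolding transition_def
  by (rule line_bundle_sections_mult'[OF coord_monomial_mem coord_monomial_mem_chart])
    (simp_all add: assms multi_indices_le[OF assms(1)])

text \<open>The section has finitely many monomials, so its poles along the coordinates of \<sigma>
  have bounded order and a high power of the numerator cancels them. The form with
  \<open>eventually\<close> lets finitely many such conditions share one power.\<close>

lemma transition_power_clears_poles:
  assumes s: "s \<in> line_bundle_sections k n d {\<sigma>, \<rho>}"
    and \<sigma>: "\<sigma> \<in> multi_indices k n" and \<rho>: "\<rho> \<in> multi_indices k n"
  shows "\<forall>\<^sub>F M in sequentially. transition k \<sigma> \<rho> ^ M * s \<in> line_bundle_sections k n d {\<rho>}"
proof -
  have "\<forall>\<^sub>F M in sequentially. - Poly_Mapping.lookup m p \<le> int M" for m :: exponent and p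
    using eventually_ge_at_top[of "nat (- Poly_Mapping.lookup m p)"] by eventually_elim linarith
  then have "\<forall>\<^sub>F M in sequentially. \<forall>p\<in>Poly_Mapping.keys m. - Poly_Mapping.lookup m p \<le> int M"
    for m :: exponent
    by (simp add: eventually_ball_finite)
  then have "\<forall>\<^sub>F M in sequentially. \<forall>m\<in>Poly_Mapping.keys s. \<forall>p\<in>Poly_Mapping.keys m.
      - Poly_Mapping.lookup m p \<le> int M"
    by (simp add: eventually_ball_finite)
  then show ?thesis
  proof eventually_elim
    case (elim M)
    \<comment> \<open>The numerator of the transition power is applied first, at the price of a
      higher multidegree; the denominator, invertible on \<open>U(\<rho>)\<close>, then restores
      d.\<close>
    let ?X = "coord_monomial k (\<lambda>_. int M) \<sigma>"
    have X: "?X * s \<in> line_bundle_sections k n (\<lambda>i. int M + d i) {\<sigma>, \<rho>}"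
      by (intro line_bundle_sections_mult[OF _ s] coord_monomial_mem) (simp_all add: multi_indices_le[OF \<sigma>])
    have "?X * s \<in> line_bundle_sections k n (\<lambda>i. int M + d i) {\<rho>}"
      unfolding line_bundle_sections_def
    proof (intro CollectI ballI conjI allI impI)
      fix m assume m: "m \<in> Poly_Mapping.keys (?X * s)"
      then show "Poly_Mapping.keys m \<subseteq> cox_vars k n" and "\<And>i. i \<in> {1..k} \<Longrightarrow> multidegree n m i = int M + d i"
        using X unfolding line_bundle_sections_def by blast+
      from m obtain m' where m': "m' \<in> Poly_Mapping.keys s" "m = coord_exponent k (\<lambda>_. int M) \<sigma> + m'"
        using keys_mult[of ?X s] by (auto simp: coord_monomial_def)
      fix i j assume neg: "Poly_Mapping.lookup m (i, j) < 0"
      then have "(i, j) \<in> Poly_Mapping.keys m" by (simp add: in_keys_iff)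
      then have i: "i \<in> {1..k}"
        using \<open>Poly_Mapping.keys m \<subseteq> cox_vars k n\<close> by (auto simp: cox_vars_def)
      have "j \<noteq> \<sigma> i"
      proof
        assume "j = \<sigma> i"
        then have "int M + Poly_Mapping.lookup m' (i, j) < 0"
          using neg i by (simp add: m' lookup_add lookup_coord_exponent)
        moreover from this have "(i, j) \<in> Poly_Mapping.keys m'" by (simp add: in_keys_iff)
        then have "- Poly_Mapping.lookup m' (i, j) \<le> int M" using elim m'(1) by blast
        ultimately show False by linarith
      qed
      moreover have "\<exists>\<sigma>'\<in>{\<sigma>, \<rho>}. j = \<sigma>' i"
        using X m neg unfolding line_bundle_sections_def by blast
      ultimately show "\<exists>\<sigma>\<in>{\<rho>}. j = \<sigma> i" by auto
    qed
    have "coord_monomial k (\<lambda>_. - int M) \<rho> \<in> line_bundle_sections k n (\<lambda>_. - int M) {\<rho>}"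
      using \<rho> by (intro coord_monomial_mem_chart) auto
    from line_bundle_sections_mult'[OF this \<open>?X * s \<in> line_bundle_sections k n _ {\<rho>}\<close>, of d]
    have "coord_monomial k (\<lambda>_. - int M) \<rho> * (?X * s) \<in> line_bundle_sections k n d {\<rho>}"
      by simp
    moreover have "transition k \<sigma> \<rho> ^ M = ?X * coord_monomial k (\<lambda>_. - int M) \<rho>"
      by (simp add: transition_def power_mult_distrib coord_monomial_power)
    ultimately show ?case
      by (simp only: mult_ac)
  qed
qed

section \<open>Zero-dimensional ideals\<close>

lemma ring_ideal_UNIV: "ring_ideal (line_bundle_sections k n (\<lambda>_. 0) \<tau>) (line_bundle_sections k n (\<lambda>_. 0) \<tau>)"
proof
  fix a b assume "a \<in> line_bundle_sections k n (\<lambda>_. 0) \<tau>" "b \<in> line_bundle_sections k n (\<lambda>_. 0) \<tau>"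
  then show "a * b \<in> line_bundle_sections k n (\<lambda>_. 0) \<tau>"
    by (rule line_bundle_sections_mult') simp
qed (auto intro: one_mem_line_bundle_sections line_bundle_sections_add line_bundle_sections_uminus
    line_bundle_sections_0 line_bundle_sections_mult')

lemma ideal_coord_ring_iff:
  "ideal I (coord_ring k n \<tau>) \<longleftrightarrow> ring_ideal (line_bundle_sections k n (\<lambda>_. 0) \<tau>) I"
proof
  let ?S = "line_bundle_sections k n (\<lambda>_. 0) \<tau>"
  interpret R: cring "coord_ring k n \<tau>" by (rule cring_coord_ring)
  interpret U: ring_ideal ?S ?S by (rule ring_ideal_UNIV)
  have [simp]: "carrier (coord_ring k n \<tau>) = ?S" "monoid.mult (coord_ring k n \<tau>) = (*)"
    "ring.zero (coord_ring k n \<tau>) = 0" "ring.add (coord_ring k n \<tau>) = (+)"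
    by (simp_all add: coord_ring_def)
  {
    assume "ideal I (coord_ring k n \<tau>)"
    then interpret I: ideal I "coord_ring k n \<tau>" .
    show "ring_ideal ?S I"
    proof
      show "I \<subseteq> ?S" using I.a_subset by simp
      show "0 \<in> I" using I.zero_closed by simp
      show "a + b \<in> I" if "a \<in> I" "b \<in> I" for a b using I.a_closed[OF that] by simp
      show "r * a \<in> I" if "r \<in> ?S" "a \<in> I" for a r using I.I_l_closed[of a r] that by simp
    qed (fact U.one_closed U.add_closed U.uminus_closed U.mult_closed)+
  next
    assume "ring_ideal ?S I"
    then interpret I: ring_ideal ?S I .
    have inv: "a_inv (coord_ring k n \<tau>) a = - a" if "a \<in> ?S" for a
      by (rule R.minus_equality) (use that U.uminus_closed in auto)
    show "ideal I (coord_ring k n \<tau>)"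
    proof (rule idealI)
      show "subgroup I (add_monoid (coord_ring k n \<tau>))"
        using I.subset I.zero_mem I.add_mem I.uminus_mem inv by (intro R.add.subgroupI) auto
    qed (use I.mult_mem I.mult_mem_right R.ring_axioms in auto)
  }
qed

lemma genideal_coord_ring:
  assumes "X \<subseteq> line_bundle_sections k n (\<lambda>_. 0) \<tau>"
  shows "ring_ideal (line_bundle_sections k n (\<lambda>_. 0) \<tau>) (genideal (coord_ring k n \<tau>) X)"
    and "X \<subseteq> genideal (coord_ring k n \<tau>) X"
    and "ring_ideal (line_bundle_sections k n (\<lambda>_. 0) \<tau>) J \<Longrightarrow> X \<subseteq> J \<Longrightarrow>
      genideal (coord_ring k n \<tau>) X \<subseteq> J"
proof -
  interpret R: cring "coord_ring k n \<tau>" by (rule cring_coord_ring)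
  have X: "X \<subseteq> carrier (coord_ring k n \<tau>)" using assms by (simp add: coord_ring_def)
  show "ring_ideal (line_bundle_sections k n (\<lambda>_. 0) \<tau>) (genideal (coord_ring k n \<tau>) X)"
    using R.genideal_ideal[OF X] by (simp add: ideal_coord_ring_iff)
  show "X \<subseteq> genideal (coord_ring k n \<tau>) X" by (rule R.genideal_self[OF X])
  show "genideal (coord_ring k n \<tau>) X \<subseteq> J"
    if "ring_ideal (line_bundle_sections k n (\<lambda>_. 0) \<tau>) J" "X \<subseteq> J"
    using that R.genideal_minimal[of J X] by (simp add: ideal_coord_ring_iff)
qed

lemma (in ring_ideal) ring_ideal_add_principal:
  assumes "g \<in> S"
  shows "ring_ideal S {a + r * g | a r. a \<in> J \<and> r \<in> S}" (is "ring_ideal S ?K")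
proof
  show "?K \<subseteq> S" using assms subset by (auto intro: add_closed mult_closed)
  show "0 \<in> ?K" using zero_mem zero_closed by force
  show "x + y \<in> ?K" if x: "x \<in> ?K" and y: "y \<in> ?K" for x y
  proof -
    obtain a r where "x = a + r * g" "a \<in> J" "r \<in> S" using x by blast
    moreover obtain b s where "y = b + s * g" "b \<in> J" "s \<in> S" using y by blast
    ultimately have "x + y = (a + b) + (r + s) * g" "a + b \<in> J" "r + s \<in> S"
      by (auto simp: algebra_simps intro: add_mem add_closed)
    then show ?thesis by blast
  qed
  show "s * x \<in> ?K" if s: "s \<in> S" and x: "x \<in> ?K" for s x
  proof -
    obtain a r where "x = a + r * g" "a \<in> J" "r \<in> S" using x by blast
    then have "s * x = s * a + (s * r) * g" "s * a \<in> J" "s * r \<in> S"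
      using s by (simp_all add: distrib_left mult.assoc mult_mem mult_closed)
    then show ?thesis by blast
  qed
qed (fact one_closed add_closed uminus_closed mult_closed)+

lemma (in ring_ideal) ring_ideal_Union_chain:
  assumes "C \<noteq> {}" "\<And>I. I \<in> C \<Longrightarrow> ring_ideal S I" "\<And>I K. I \<in> C \<Longrightarrow> K \<in> C \<Longrightarrow> I \<subseteq> K \<or> K \<subseteq> I"
  shows "ring_ideal S (\<Union>C)"
proof
  show "\<Union>C \<subseteq> S" using assms(2) ring_ideal.subset by blast
  show "0 \<in> \<Union>C" using assms(1,2) ring_ideal.zero_mem by blast
  show "a + b \<in> \<Union>C" if ab: "a \<in> \<Union>C" "b \<in> \<Union>C" for a b
  proof -
    obtain I K where IK: "a \<in> I" "b \<in> K" "I \<in> C" "K \<in> C" using ab by blast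
    with assms(3) obtain M where "M \<in> C" "a \<in> M" "b \<in> M" by blast
    then show ?thesis using assms(2) ring_ideal.add_mem by blast
  qed
  show "r * a \<in> \<Union>C" if "r \<in> S" "a \<in> \<Union>C" for r a
    using that assms(2) ring_ideal.mult_mem by blast
qed (fact one_closed add_closed uminus_closed mult_closed)+

text \<open>An ideal that is maximal among those avoiding a multiplicative set is prime.\<close>

lemma (in ring_ideal) prime_ideal_avoiding:
  assumes "1 \<in> M" "\<And>a b. a \<in> M \<Longrightarrow> b \<in> M \<Longrightarrow> a * b \<in> M" "J \<inter> M = {}"
  obtains P where "ring_ideal S P" "J \<subseteq> P" "P \<inter> M = {}"
    "\<And>a b. a \<in> S \<Longrightarrow> b \<in> S \<Longrightarrow> a * b \<in> P \<Longrightarrow> a \<in> P \<or> b \<in> P"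
proof -
  let ?A = "{I. ring_ideal S I \<and> J \<subseteq> I \<and> I \<inter> M = {}}"
  have "\<exists>P\<in>?A. \<forall>X\<in>?A. P \<subseteq> X \<longrightarrow> X = P"
  proof (rule subset_Zorn_nonempty)
    show "?A \<noteq> {}" using assms(3) ring_ideal_axioms by blast
    fix C assume C: "C \<noteq> {}" "subset.chain ?A C"
    then have "ring_ideal S (\<Union>C)"
      by (intro ring_ideal_Union_chain) (auto simp: subset_chain_def)
    moreover have "C \<subseteq> ?A" using C(2) by (simp add: subset_chain_def)
    then have "J \<subseteq> \<Union>C" "\<Union>C \<inter> M = {}" using C(1) by blast+
    ultimately show "\<Union>C \<in> ?A" by simp
  qed
  then obtain P where "P \<in> ?A" and "\<forall>X\<in>?A. P \<subseteq> X \<longrightarrow> X = P" ..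
  then have P: "ring_ideal S P" "J \<subseteq> P" "P \<inter> M = {}"
    and max: "\<And>X. ring_ideal S X \<Longrightarrow> J \<subseteq> X \<Longrightarrow> X \<inter> M = {} \<Longrightarrow> P \<subseteq> X \<Longrightarrow> X = P"
    by simp_all
  interpret P: ring_ideal S P by fact
  \<comment> \<open>The ideal generated by P and a is strictly larger than P, so by maximality it
    meets M.\<close>
  have ex: "\<exists>p r. p \<in> P \<and> r \<in> S \<and> p + r * a \<in> M" if "a \<in> S" "a \<notin> P" for a
  proof (rule ccontr)
    let ?X = "{p + r * a | p r. p \<in> P \<and> r \<in> S}"
    assume "\<not> ?thesis"
    then have "?X \<inter> M = {}" by blast
    moreover have "P \<subseteq> ?X" using P.zero_closed by force
    moreover have "ring_ideal S ?X" using P.ring_ideal_add_principal that(1) .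
    ultimately have "?X = P" using max P(2) by blast
    moreover have "0 + 1 * a \<in> ?X" using P.zero_mem P.one_closed by blast
    ultimately show False using that(2) by simp
  qed
  have "a \<in> P \<or> b \<in> P" if "a \<in> S" "b \<in> S" and ab: "a * b \<in> P" for a b
  proof (rule ccontr)
    assume "\<not> ?thesis"
    then obtain p r q s where pr: "p \<in> P" "r \<in> S" "p + r * a \<in> M" "q \<in> P" "s \<in> S" "q + s * b \<in> M"
      using ex \<open>a \<in> S\<close> \<open>b \<in> S\<close> by meson
    have "(p + r * a) * (q + s * b) = p * (q + s * b) + r * a * q + (r * s) * (a * b)"
      by (simp add: algebra_simps)
    also have "\<dots> \<in> P"
    proof (intro P.add_mem)
      show "p * (q + s * b) \<in> P"
        using pr that P.subset by (intro P.mult_mem_right add_closed mult_closed) auto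
      show "r * a * q \<in> P" using pr that by (intro P.mult_mem mult_closed)
      show "(r * s) * (a * b) \<in> P" using pr by (intro P.mult_mem[OF _ ab] mult_closed)
    qed
    finally show False using assms(2) pr P(3) by blast
  qed
  with P show ?thesis using that by blast
qed

lemma closed_subscheme_ring_ideal:
  "closed_subscheme k n Z \<Longrightarrow> \<sigma> \<in> multi_indices k n \<Longrightarrow>
    ring_ideal (line_bundle_sections k n (\<lambda>_. 0) {\<sigma>}) (Z \<sigma>)"
  by (simp add: closed_subscheme_def ideal_coord_ring_iff)

text \<open>If no power of \<open>f\<close> is divisible by the next one modulo \<open>Z \<rho>\<close>, then some prime ideal
  contains \<open>Z \<rho>\<close> and avoids all \<open>f ^ N * (1 - b * f)\<close>; it is not maximal, as \<open>f\<close> is a non-unit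
  modulo it.\<close>

lemma zero_dim_pi_regular:
  assumes Z: "zero_dim_scheme k n Z" and \<rho>: "\<rho> \<in> multi_indices k n"
    and f: "f \<in> line_bundle_sections k n (\<lambda>_. 0) {\<rho>}"
  shows "\<exists>b\<in>line_bundle_sections k n (\<lambda>_. 0) {\<rho>}. \<exists>N. f ^ N * (b * f - 1) \<in> Z \<rho>"
proof (rule ccontr)
  let ?S = "line_bundle_sections k n (\<lambda>_. 0) {\<rho>}"
  assume contra: "\<not> ?thesis"
  interpret I: ring_ideal ?S "Z \<rho>"
    using Z \<rho> closed_subscheme_ring_ideal by (auto simp: zero_dim_scheme_def)
  let ?M = "{f ^ N * (1 - b * f) | N b. b \<in> ?S}"
  have M1: "1 - b * f \<in> ?M" if "b \<in> ?S" for b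
    using that by (intro CollectI exI[of _ 0] exI[of _ b]) simp
  have fM: "f \<in> ?M"
    using I.zero_closed by (intro CollectI exI[of _ 1] exI[of _ 0]) simp
  have disj: "Z \<rho> \<inter> ?M = {}"
  proof -
    have "f ^ N * (1 - b * f) \<notin> Z \<rho>" if "b \<in> ?S" for N b
    proof
      assume "f ^ N * (1 - b * f) \<in> Z \<rho>"
      then have "- (f ^ N * (1 - b * f)) \<in> Z \<rho>" by (rule I.uminus_mem)
      then have "f ^ N * (b * f - 1) \<in> Z \<rho>" by (simp add: algebra_simps)
      then show False using contra that by blast
    qed
    then show ?thesis by blast
  qed
  have mult: "x * y \<in> ?M" if xy: "x \<in> ?M" "y \<in> ?M" for x y
  proof -
    obtain N b N' b' where *: "x = f ^ N * (1 - b * f)" "y = f ^ N' * (1 - b' * f)" "b \<in> ?S" "b' \<in> ?S"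
      using xy by blast
    have "x * y = f ^ (N + N') * (1 - (b + b' - b * b' * f) * f)"
      unfolding *(1,2) by (simp add: algebra_simps power_add)
    moreover have "b + b' - b * b' * f \<in> ?S"
      using * f by (intro I.diff_closed I.add_closed I.mult_closed)
    ultimately show ?thesis by blast
  qed
  have one: "1 \<in> ?M" using M1[OF I.zero_closed] by simp
  obtain P where P: "ring_ideal ?S P" "Z \<rho> \<subseteq> P" "P \<inter> ?M = {}"
    and prime: "\<And>a b. a \<in> ?S \<Longrightarrow> b \<in> ?S \<Longrightarrow> a * b \<in> P \<Longrightarrow> a \<in> P \<or> b \<in> P"
    by (rule I.prime_ideal_avoiding[OF one mult disj]) (assumption | rule that)+
  interpret P: ring_ideal ?S P by fact
  have car: "carrier (coord_ring k n {\<rho>}) = ?S" by (simp add: coord_ring_def)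
  have "1 \<notin> P" using P(3) one by blast
  have "primeideal P (coord_ring k n {\<rho>})"
  proof (rule primeidealI)
    show "ideal P (coord_ring k n {\<rho>})" using P(1) by (simp add: ideal_coord_ring_iff)
    show "carrier (coord_ring k n {\<rho>}) \<noteq> P" using \<open>1 \<notin> P\<close> I.one_closed car by blast
    show "a \<in> P \<or> b \<in> P" if "a \<in> carrier (coord_ring k n {\<rho>})" "b \<in> carrier (coord_ring k n {\<rho>})"
      "a \<otimes>\<^bsub>coord_ring k n {\<rho>}\<^esub> b \<in> P" for a b
      using prime[of a b] that by (simp add: coord_ring_def)
  qed (rule cring_coord_ring)
  then have "maximalideal P (coord_ring k n {\<rho>})"
    using Z \<rho> P(2) by (auto simp: zero_dim_scheme_def)
  then interpret mx: maximalideal P "coord_ring k n {\<rho>}" .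
  \<comment> \<open>As f lies in \<open>?M\<close>, it is not in P, and maximality of P makes this
    ideal the whole ring. An inverse r of f modulo P then puts \<open>1 - r * f\<close>, an element
    of \<open>?M\<close>, into P.\<close>
  let ?X = "{p + r * f | p r. p \<in> P \<and> r \<in> ?S}"
  have X: "ring_ideal ?S ?X" by (rule P.ring_ideal_add_principal[OF f])
  have "P \<subseteq> ?X" using P.zero_closed by force
  moreover have "?X \<noteq> P"
  proof
    assume "?X = P"
    moreover have "0 + 1 * f \<in> ?X" using P.zero_mem P.one_closed by blast
    ultimately show False using P(3) fM by auto
  qed
  ultimately have "?X = ?S"
    using mx.I_maximal[unfolded ideal_coord_ring_iff car, OF X _ ring_ideal.subset[OF X]] by blast
  then obtain p r where "1 = p + r * f" "p \<in> P" "r \<in> ?S" using I.one_closed by blast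
  then have "1 - r * f \<in> P" by (metis add_diff_cancel_right')
  then show False using M1[OF \<open>r \<in> ?S\<close>] P(3) by blast
qed

section \<open>Sections of twisted ideal sheaves\<close>

lemma zero_dim_closed: "zero_dim_scheme k n Z \<Longrightarrow> closed_subscheme k n Z"
  by (simp add: zero_dim_scheme_def)

context
  fixes k :: nat and n :: "nat \<Rightarrow> nat" and Z :: ideal_data
  assumes Z: "closed_subscheme k n Z"
begin

lemma chart_ideal_subset:
  assumes "\<tau> \<subseteq> multi_indices k n" "\<sigma> \<in> \<tau>"
  shows "Z \<sigma> \<subseteq> line_bundle_sections k n (\<lambda>_. 0) \<tau>"
  using ring_ideal.subset[OF closed_subscheme_ring_ideal[OF Z, of \<sigma>]]
    line_bundle_sections_mono[of "{\<sigma>}" \<tau>] assms by blast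

lemma ideal_sections_ring_ideal:
  "\<tau> \<subseteq> multi_indices k n \<Longrightarrow>
    ring_ideal (line_bundle_sections k n (\<lambda>_. 0) \<tau>) (ideal_sections k n Z \<tau>)"
  unfolding ideal_sections_def using chart_ideal_subset by (intro genideal_coord_ring) blast

lemma chart_ideal_subset_ideal_sections:
  assumes "\<tau> \<subseteq> multi_indices k n" "\<sigma> \<in> \<tau>"
  shows "Z \<sigma> \<subseteq> ideal_sections k n Z \<tau>"
proof -
  have "(\<Union>\<sigma>\<in>\<tau>. Z \<sigma>) \<subseteq> ideal_sections k n Z \<tau>"
    unfolding ideal_sections_def using chart_ideal_subset assms(1) by (intro genideal_coord_ring) blast
  then show ?thesis using assms(2) by blast
qed

lemma ideal_sections_chart:
  assumes "\<sigma> \<in> multi_indices k n"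
  shows "ideal_sections k n Z {\<sigma>} = Z \<sigma>"
proof
  show "ideal_sections k n Z {\<sigma>} \<subseteq> Z \<sigma>"
    unfolding ideal_sections_def
    using genideal_coord_ring(3)[OF _ closed_subscheme_ring_ideal[OF Z assms], of "Z \<sigma>"]
      chart_ideal_subset[of "{\<sigma>}" \<sigma>] assms by simp
  show "Z \<sigma> \<subseteq> ideal_sections k n Z {\<sigma>}"
    using chart_ideal_subset_ideal_sections assms by simp
qed

lemma ideal_sections_pair:
  assumes "\<sigma> \<in> multi_indices k n" "\<rho> \<in> multi_indices k n"
  shows "ideal_sections k n Z {\<sigma>, \<rho>} = genideal (coord_ring k n {\<sigma>, \<rho>}) (Z \<rho>)"
proof
  have sub: "Z \<sigma> \<subseteq> line_bundle_sections k n (\<lambda>_. 0) {\<sigma>, \<rho>}"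
      "Z \<rho> \<subseteq> line_bundle_sections k n (\<lambda>_. 0) {\<sigma>, \<rho>}"
    using chart_ideal_subset assms by auto
  have "genideal (coord_ring k n {\<sigma>, \<rho>}) (Z \<sigma>) = genideal (coord_ring k n {\<sigma>, \<rho>}) (Z \<rho>)"
    using Z assms unfolding closed_subscheme_def by blast
  then have "Z \<sigma> \<union> Z \<rho> \<subseteq> genideal (coord_ring k n {\<sigma>, \<rho>}) (Z \<rho>)"
    using genideal_coord_ring(2)[OF sub(1)] genideal_coord_ring(2)[OF sub(2)] by simp
  then show "ideal_sections k n Z {\<sigma>, \<rho>} \<subseteq> genideal (coord_ring k n {\<sigma>, \<rho>}) (Z \<rho>)"
    unfolding ideal_sections_def using sub
    by (intro genideal_coord_ring(3) genideal_coord_ring(1)) auto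
  show "genideal (coord_ring k n {\<sigma>, \<rho>}) (Z \<rho>) \<subseteq> ideal_sections k n Z {\<sigma>, \<rho>}"
    using assms sub chart_ideal_subset_ideal_sections
    by (intro genideal_coord_ring(3) ideal_sections_ring_ideal) auto
qed

text \<open>The ring of the overlap arises from that of \<open>U(\<rho>)\<close> by inverting the
  transition function. The elements that some power of it carries into \<open>Z \<rho>\<close> form
  an ideal of the larger ring, and this ideal contains \<open>Z \<rho>\<close>, which generates the
  ideal of the overlap.\<close>

lemma ideal_sections_clear_poles:
  assumes \<sigma>: "\<sigma> \<in> multi_indices k n" and \<rho>: "\<rho> \<in> multi_indices k n"
    and a: "a \<in> ideal_sections k n Z {\<sigma>, \<rho>}"
  shows "\<forall>\<^sub>F M in sequentially. transition k \<sigma> \<rho> ^ M * a \<in> Z \<rho>"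
proof -
  let ?t = "transition k \<sigma> \<rho>" and ?S = "line_bundle_sections k n (\<lambda>_. 0)"
  interpret Z: ring_ideal "?S {\<rho>}" "Z \<rho>" by (rule closed_subscheme_ring_ideal[OF Z \<rho>])
  interpret R: ring_ideal "?S {\<sigma>, \<rho>}" "?S {\<sigma>, \<rho>}" by (rule ring_ideal_UNIV)
  have t: "?t \<in> ?S {\<rho>}" using \<sigma> \<rho> by (intro transition_mem) auto
  let ?K = "{y \<in> ?S {\<sigma>, \<rho>}. \<exists>N. ?t ^ N * y \<in> Z \<rho>}"
  have shift: "?t ^ (N + N') * y \<in> Z \<rho>" if "?t ^ N * y \<in> Z \<rho>" for N N' y
    using Z.mult_mem[OF Z.power_closed[OF t, of N'] that] by (simp add: power_add mult_ac)
  have "ring_ideal (?S {\<sigma>, \<rho>}) ?K"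
  proof
    show "0 \<in> ?K" using Z.zero_mem R.zero_closed by simp
    show "x + y \<in> ?K" if x: "x \<in> ?K" and y: "y \<in> ?K" for x y
    proof -
      obtain N where "?t ^ N * x \<in> Z \<rho>" using x by blast
      moreover obtain N' where "?t ^ N' * y \<in> Z \<rho>" using y by blast
      ultimately have "?t ^ (N + N') * x + ?t ^ (N' + N) * y \<in> Z \<rho>"
        using shift by (intro Z.add_mem)
      then have "?t ^ (N + N') * (x + y) \<in> Z \<rho>" by (simp add: algebra_simps)
      then show ?thesis using x y R.add_closed by blast
    qed
    show "r * x \<in> ?K" if r: "r \<in> ?S {\<sigma>, \<rho>}" and x: "x \<in> ?K" for r x
    proof -
      obtain N where N: "?t ^ N * x \<in> Z \<rho>" using x by blast
      \<comment> \<open>The factor r may have poles on \<open>U(\<rho>)\<close>, so an extra power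
        is spent on clearing them.\<close>
      obtain N' where "?t ^ N' * r \<in> ?S {\<rho>}"
        using eventually_happens'[OF _ transition_power_clears_poles[OF r \<sigma> \<rho>]] by auto
      from Z.mult_mem[OF this N] have "?t ^ (N + N') * (r * x) \<in> Z \<rho>"
        by (simp add: power_add mult_ac)
      then show ?thesis using x r R.mult_closed by blast
    qed
  qed (use R.one_closed R.add_closed R.uminus_closed R.mult_closed in auto)
  moreover have sub: "Z \<rho> \<subseteq> ?S {\<sigma>, \<rho>}" using chart_ideal_subset \<sigma> \<rho> by auto
  moreover have "Z \<rho> \<subseteq> ?K" using sub by (auto intro!: exI[of _ 0])
  ultimately have "a \<in> ?K"
    using a genideal_coord_ring(3)[OF sub] unfolding ideal_sections_pair[OF \<sigma> \<rho>] by blast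
  then obtain N where "?t ^ N * a \<in> Z \<rho>" by blast
  then have "?t ^ M * a \<in> Z \<rho>" if "N \<le> M" for M
    using shift[of N a "M - N"] that by simp
  then show ?thesis unfolding eventually_sequentially by blast
qed

text \<open>Over \<open>U(\<tau>)\<close> the line bundle is free on the monomial of any \<sigma> in
  \<tau>, so dividing by that generator reduces a twisted ideal to an ordinary one.\<close>

lemma twisted_ideal_sections_iff:
  assumes \<tau>: "\<tau> \<subseteq> multi_indices k n" and \<sigma>: "\<sigma> \<in> \<tau>"
  shows "f \<in> twisted_ideal_sections k n Z d \<tau> \<longleftrightarrow>
    f * coord_monomial k (\<lambda>i. - d i) \<sigma> \<in> ideal_sections k n Z \<tau>"
proof
  let ?X = "coord_monomial k d \<sigma>" and ?Y = "coord_monomial k (\<lambda>i. - d i) \<sigma>"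
  have \<sigma>': "\<sigma> \<in> multi_indices k n" using assms by blast
  interpret I: ring_ideal "line_bundle_sections k n (\<lambda>_. 0) \<tau>" "ideal_sections k n Z \<tau>"
    by (rule ideal_sections_ring_ideal[OF \<tau>])
  {
    assume "f \<in> twisted_ideal_sections k n Z d \<tau>"
    then obtain N a b where f: "f = (\<Sum>r<(N::nat). a r * b r)"
      and ab: "\<And>r. r < N \<Longrightarrow> a r \<in> ideal_sections k n Z \<tau>"
        "\<And>r. r < N \<Longrightarrow> b r \<in> line_bundle_sections k n d \<tau>"
      unfolding twisted_ideal_sections_def by blast
    have "f * ?Y = (\<Sum>r<N. a r * (b r * ?Y))"
      by (simp add: f sum_distrib_right mult.assoc)
    also have "\<dots> \<in> ideal_sections k n Z \<tau>"
    proof (intro I.sum_mem I.mult_mem_right)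
      show "b r * ?Y \<in> line_bundle_sections k n (\<lambda>_. 0) \<tau>" if "r \<in> {..<N}" for r
        using line_bundle_sections_mult'[OF ab(2) coord_monomial_mem_chart[OF \<sigma>' \<sigma>]] that by auto
    qed (use ab in auto)
    finally show "f * ?Y \<in> ideal_sections k n Z \<tau>" .
  next
    assume "f * ?Y \<in> ideal_sections k n Z \<tau>"
    moreover have "?X \<in> line_bundle_sections k n d \<tau>"
      using coord_monomial_mem_chart[OF \<sigma>' \<sigma>] .
    moreover have "f = (\<Sum>r<(1::nat). f * ?Y * ?X)"
      by (simp add: mult.assoc coord_monomial_inverse)
    ultimately show "f \<in> twisted_ideal_sections k n Z d \<tau>"
      unfolding twisted_ideal_sections_def
      by (intro CollectI exI[of _ "1::nat"] exI[of _ "\<lambda>_. f * ?Y"] exI[of _ "\<lambda>_. ?X"]) auto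
  }
qed

lemma twisted_ideal_sections_0:
  assumes "\<tau> \<subseteq> multi_indices k n" "\<tau> \<noteq> {}"
  shows "twisted_ideal_sections k n Z (\<lambda>_. 0) \<tau> = ideal_sections k n Z \<tau>"
  using assms twisted_ideal_sections_iff[OF assms(1), of _ _ "\<lambda>_. 0"]
  by (auto simp: coord_monomial_0)

lemma twisted_ideal_sections_0_chart:
  "\<sigma> \<in> multi_indices k n \<Longrightarrow> twisted_ideal_sections k n Z (\<lambda>_. 0) {\<sigma>} = Z \<sigma>"
  by (simp add: twisted_ideal_sections_0 ideal_sections_chart)

lemma twisted_ideal_sections_mult:
  assumes \<tau>: "\<tau> \<subseteq> multi_indices k n" "\<tau> \<noteq> {}"
    and s: "s \<in> line_bundle_sections k n d \<tau>" and a: "a \<in> twisted_ideal_sections k n Z e \<tau>"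
    and de: "\<And>i. i \<in> {1..k} \<Longrightarrow> d i + e i = d' i"
  shows "s * a \<in> twisted_ideal_sections k n Z d' \<tau>"
proof -
  obtain \<sigma> where \<sigma>: "\<sigma> \<in> \<tau>" "\<sigma> \<in> multi_indices k n" using \<tau> by blast
  interpret I: ring_ideal "line_bundle_sections k n (\<lambda>_. 0) \<tau>" "ideal_sections k n Z \<tau>"
    by (rule ideal_sections_ring_ideal[OF \<tau>(1)])
  have "coord_monomial k (\<lambda>i. - d' i) \<sigma> = coord_monomial k (\<lambda>i. - d i) \<sigma> * coord_monomial k (\<lambda>i. - e i) \<sigma>"
    unfolding coord_monomial_mult by (rule coord_monomial_cong) (use de in fastforce)
  then have "s * a * coord_monomial k (\<lambda>i. - d' i) \<sigma> =
      (s * coord_monomial k (\<lambda>i. - d i) \<sigma>) * (a * coord_monomial k (\<lambda>i. - e i) \<sigma>)"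
    by (simp add: mult_ac)
  moreover have "s * coord_monomial k (\<lambda>i. - d i) \<sigma> \<in> line_bundle_sections k n (\<lambda>_. 0) \<tau>"
    by (rule line_bundle_sections_mult'[OF s coord_monomial_mem_chart[OF \<sigma>(2,1)]]) simp
  moreover have "a * coord_monomial k (\<lambda>i. - e i) \<sigma> \<in> ideal_sections k n Z \<tau>"
    using a twisted_ideal_sections_iff[OF \<tau>(1) \<sigma>(1)] by blast
  ultimately show ?thesis
    using I.mult_mem twisted_ideal_sections_iff[OF \<tau>(1) \<sigma>(1)] by simp
qed

lemma twisted_ideal_sections_subset:
  assumes \<tau>: "\<tau> \<subseteq> multi_indices k n" "\<tau> \<noteq> {}" and a: "a \<in> twisted_ideal_sections k n Z d \<tau>"
  shows "a \<in> line_bundle_sections k n d \<tau>"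
proof -
  obtain \<sigma> where \<sigma>: "\<sigma> \<in> \<tau>" "\<sigma> \<in> multi_indices k n" using \<tau> by blast
  interpret I: ring_ideal "line_bundle_sections k n (\<lambda>_. 0) \<tau>" "ideal_sections k n Z \<tau>"
    by (rule ideal_sections_ring_ideal[OF \<tau>(1)])
  have "a * coord_monomial k (\<lambda>i. - d i) \<sigma> \<in> line_bundle_sections k n (\<lambda>_. 0) \<tau>"
    using a twisted_ideal_sections_iff[OF \<tau>(1) \<sigma>(1)] I.subset by blast
  from line_bundle_sections_mult'[OF this coord_monomial_mem_chart[OF \<sigma>(2,1)], of d d]
  show ?thesis by (simp add: mult.assoc coord_monomial_inverse)
qed

lemma twisted_ideal_sections_add:
  assumes \<tau>: "\<tau> \<subseteq> multi_indices k n" "\<tau> \<noteq> {}"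
    and "a \<in> twisted_ideal_sections k n Z d \<tau>" "b \<in> twisted_ideal_sections k n Z d \<tau>"
  shows "a + b \<in> twisted_ideal_sections k n Z d \<tau>"
proof -
  obtain \<sigma> where \<sigma>: "\<sigma> \<in> \<tau>" using \<tau> by blast
  interpret I: ring_ideal "line_bundle_sections k n (\<lambda>_. 0) \<tau>" "ideal_sections k n Z \<tau>"
    by (rule ideal_sections_ring_ideal[OF \<tau>(1)])
  show ?thesis
    using assms I.add_mem by (simp add: twisted_ideal_sections_iff[OF \<tau>(1) \<sigma>] distrib_right)
qed

lemma twisted_ideal_sections_zero:
  assumes \<tau>: "\<tau> \<subseteq> multi_indices k n" "\<tau> \<noteq> {}"
  shows "0 \<in> twisted_ideal_sections k n Z d \<tau>"
proof -
  obtain \<sigma> where \<sigma>: "\<sigma> \<in> \<tau>" using \<tau> by blast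
  interpret I: ring_ideal "line_bundle_sections k n (\<lambda>_. 0) \<tau>" "ideal_sections k n Z \<tau>"
    by (rule ideal_sections_ring_ideal[OF \<tau>(1)])
  show ?thesis
    using I.zero_mem by (simp add: twisted_ideal_sections_iff[OF \<tau>(1) \<sigma>])
qed

lemma twisted_ideal_sections_scale:
  assumes "\<tau> \<subseteq> multi_indices k n" "\<tau> \<noteq> {}" "a \<in> twisted_ideal_sections k n Z d \<tau>"
  shows "Poly_Mapping.single 0 x * a \<in> twisted_ideal_sections k n Z d \<tau>"
  by (rule twisted_ideal_sections_mult[OF assms(1,2) const_mem_line_bundle_sections assms(3)]) simp

lemma twisted_ideal_sections_diff:
  assumes \<tau>: "\<tau> \<subseteq> multi_indices k n" "\<tau> \<noteq> {}"
    and "a \<in> twisted_ideal_sections k n Z d \<tau>" "b \<in> twisted_ideal_sections k n Z d \<tau>"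
  shows "a - b \<in> twisted_ideal_sections k n Z d \<tau>"
  using twisted_ideal_sections_add[OF \<tau> assms(3) twisted_ideal_sections_scale[OF \<tau> assms(4), of "- 1"]]
  by (simp add: single_uminus)

lemma twisted_ideal_sections_sum:
  assumes "\<tau> \<subseteq> multi_indices k n" "\<tau> \<noteq> {}"
    and "\<And>i. i \<in> I \<Longrightarrow> f i \<in> twisted_ideal_sections k n Z d \<tau>"
  shows "sum f I \<in> twisted_ideal_sections k n Z d \<tau>"
  using assms(3)
  by (induction I rule: infinite_finite_induct)
    (simp_all add: twisted_ideal_sections_zero[OF assms(1,2)] twisted_ideal_sections_add[OF assms(1,2)])

lemma twisted_ideal_sections_mono:
  assumes "\<tau> \<subseteq> multi_indices k n" "\<sigma> \<in> \<tau>" "a \<in> twisted_ideal_sections k n Z d {\<sigma>}"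
  shows "a \<in> twisted_ideal_sections k n Z d \<tau>"
proof -
  have \<sigma>: "\<sigma> \<in> multi_indices k n" using assms by blast
  then have "a * coord_monomial k (\<lambda>i. - d i) \<sigma> \<in> Z \<sigma>"
    using assms(3) twisted_ideal_sections_iff[of "{\<sigma>}" \<sigma>] by (simp add: ideal_sections_chart)
  then show ?thesis
    using chart_ideal_subset_ideal_sections[OF assms(1,2)] twisted_ideal_sections_iff[OF assms(1,2)]
    by blast
qed

lemma twisted_ideal_sections_clear_poles:
  assumes \<sigma>: "\<sigma> \<in> multi_indices k n" and \<rho>: "\<rho> \<in> multi_indices k n"
    and a: "a \<in> twisted_ideal_sections k n Z d {\<sigma>}"
  shows "\<forall>\<^sub>F M in sequentially. transition k \<sigma> \<rho> ^ M * a \<in> twisted_ideal_sections k n Z d {\<rho>}"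
proof -
  have "a \<in> twisted_ideal_sections k n Z d {\<sigma>, \<rho>}"
    by (rule twisted_ideal_sections_mono[OF _ _ a]) (use \<sigma> \<rho> in auto)
  then have "a * coord_monomial k (\<lambda>i. - d i) \<rho> \<in> ideal_sections k n Z {\<sigma>, \<rho>}"
    using twisted_ideal_sections_iff[of "{\<sigma>, \<rho>}" \<rho>] \<sigma> \<rho> by simp
  from ideal_sections_clear_poles[OF \<sigma> \<rho> this] show ?thesis
    using twisted_ideal_sections_iff[of "{\<rho>}" \<rho> _ d] \<rho> by (simp add: ideal_sections_chart mult.assoc)
qed

end

section \<open>Partitions of unity\<close>

text \<open>There are finitely many pairs of charts, and by \<open>pi_regular_mono\<close> an
  exponent may be enlarged; the sum of the individual exponents therefore serves every pair.\<close>

lemma zero_dim_uniform_pi_regular: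
  assumes Z: "zero_dim_scheme k n Z"
  obtains b M where
    "\<And>\<sigma> \<rho>. \<sigma> \<in> multi_indices k n \<Longrightarrow> \<rho> \<in> multi_indices k n \<Longrightarrow>
      b \<sigma> \<rho> \<in> line_bundle_sections k n (\<lambda>_. 0) {\<rho>}"
    "\<And>\<sigma> \<rho>. \<sigma> \<in> multi_indices k n \<Longrightarrow> \<rho> \<in> multi_indices k n \<Longrightarrow>
      transition k \<sigma> \<rho> ^ M * (b \<sigma> \<rho> * transition k \<sigma> \<rho> - 1) \<in> Z \<rho>"
proof -
  let ?I = "multi_indices k n" and ?S = "\<lambda>\<rho>. line_bundle_sections k n (\<lambda>_. 0) {\<rho>}"
  have t: "transition k \<sigma> \<rho> \<in> ?S \<rho>" if "\<sigma> \<in> ?I" "\<rho> \<in> ?I" for \<sigma> \<rho>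
    using that by (intro transition_mem) auto
  have "\<forall>\<sigma>\<in>?I. \<forall>\<rho>\<in>?I. \<exists>b\<in>?S \<rho>. \<exists>N. transition k \<sigma> \<rho> ^ N * (b * transition k \<sigma> \<rho> - 1) \<in> Z \<rho>"
    using zero_dim_pi_regular[OF Z _ t] by blast
  then obtain b N where b: "\<And>\<sigma> \<rho>. \<sigma> \<in> ?I \<Longrightarrow> \<rho> \<in> ?I \<Longrightarrow> b \<sigma> \<rho> \<in> ?S \<rho>"
    and N: "\<And>\<sigma> \<rho>. \<sigma> \<in> ?I \<Longrightarrow> \<rho> \<in> ?I \<Longrightarrow>
      transition k \<sigma> \<rho> ^ N \<sigma> \<rho> * (b \<sigma> \<rho> * transition k \<sigma> \<rho> - 1) \<in> Z \<rho>"
    by metis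
  define M where "M = (\<Sum>\<sigma>\<in>?I. \<Sum>\<rho>\<in>?I. N \<sigma> \<rho>)"
  have le: "N \<sigma> \<rho> \<le> M" if "\<sigma> \<in> ?I" "\<rho> \<in> ?I" for \<sigma> \<rho>
  proof -
    have "N \<sigma> \<rho> \<le> (\<Sum>\<rho>\<in>?I. N \<sigma> \<rho>)"
      using that finite_multi_indices by (intro member_le_sum) auto
    also have "\<dots> \<le> M"
      unfolding M_def using that finite_multi_indices
      by (intro member_le_sum[of \<sigma> ?I "\<lambda>\<sigma>. \<Sum>\<rho>\<in>?I. N \<sigma> \<rho>"]) auto
    finally show ?thesis .
  qed
  show ?thesis
  proof (rule that)
    fix \<sigma> \<rho> assume *: "\<sigma> \<in> ?I" "\<rho> \<in> ?I"
    then show "b \<sigma> \<rho> \<in> ?S \<rho>" by (rule b)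
    interpret I: ring_ideal "?S \<rho>" "Z \<rho>"
      using closed_subscheme_ring_ideal zero_dim_closed[OF Z] *(2) by blast
    show "transition k \<sigma> \<rho> ^ M * (b \<sigma> \<rho> * transition k \<sigma> \<rho> - 1) \<in> Z \<rho>"
      using I.pi_regular_mono[OF N t le] * by blast
  qed
qed

text \<open>\<open>q j \<rho> * transition k (s j) \<rho> ^ D\<close> is the restriction to the chart \<open>\<rho>\<close> of a global function
  on \<open>Z\<close>, supported in the chart \<open>s j\<close>; these functions are orthogonal idempotents with sum 1.
  The factor \<open>transition k (s j) \<rho> ^ D\<close> allows to extend by zero sections that are defined only
  on the chart \<open>s j\<close>.\<close>

lemma partition_of_unity:
  assumes Z: "zero_dim_scheme k n Z"
  obtains m :: nat and s q where
    "\<And>j. j < m \<Longrightarrow> s j \<in> multi_indices k n"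
    "\<And>j \<rho>. j < m \<Longrightarrow> \<rho> \<in> multi_indices k n \<Longrightarrow> q j \<rho> \<in> line_bundle_sections k n (\<lambda>_. 0) {\<rho>}"
    "\<And>\<rho>. \<rho> \<in> multi_indices k n \<Longrightarrow> 1 - (\<Sum>j<m. q j \<rho> * transition k (s j) \<rho> ^ D) \<in> Z \<rho>"
    "\<And>i j \<rho>. i < m \<Longrightarrow> j < m \<Longrightarrow> i \<noteq> j \<Longrightarrow> \<rho> \<in> multi_indices k n \<Longrightarrow>
      q i \<rho> * transition k (s i) \<rho> ^ D * q j \<rho> \<in> Z \<rho>"
    "\<And>j \<rho> \<rho>'. j < m \<Longrightarrow> \<rho> \<in> multi_indices k n \<Longrightarrow> \<rho>' \<in> multi_indices k n \<Longrightarrow>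
      q j \<rho> - q j \<rho>' * transition k \<rho> \<rho>' ^ D \<in> ideal_sections k n Z {\<rho>, \<rho>'}"
proof -
  let ?I = "multi_indices k n" and ?S = "\<lambda>\<tau>. line_bundle_sections k n (\<lambda>_. 0) \<tau>"
  note cl = zero_dim_closed[OF Z]
  obtain b M where b: "\<And>\<sigma> \<rho>. \<sigma> \<in> ?I \<Longrightarrow> \<rho> \<in> ?I \<Longrightarrow> b \<sigma> \<rho> \<in> ?S {\<rho>}"
    and bM: "\<And>\<sigma> \<rho>. \<sigma> \<in> ?I \<Longrightarrow> \<rho> \<in> ?I \<Longrightarrow>
      transition k \<sigma> \<rho> ^ M * (b \<sigma> \<rho> * transition k \<sigma> \<rho> - 1) \<in> Z \<rho>"
    by (rule zero_dim_uniform_pi_regular[OF Z]) blast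
  obtain s :: "nat \<Rightarrow> nat \<Rightarrow> nat" and m where "?I = s ` {i. i < m}"
    using finite_imp_nat_seg_image_inj_on[OF finite_multi_indices] by blast
  then have s: "\<And>j. j < m \<Longrightarrow> s j \<in> ?I" and surj: "\<And>\<rho>. \<rho> \<in> ?I \<Longrightarrow> \<exists>j<m. s j = \<rho>"
    by auto
  \<comment> \<open>Of the N factors of t in the idempotent, D are split off as the transition power
    and M stay in q. These M make q independent of the chosen quasi-inverse modulo the
    ideal.\<close>
  define N where "N = M + D"
  define t where "t j \<rho> = transition k (s j) \<rho>" for j \<rho>
  define e where "e j \<rho> = (b (s j) \<rho> * t j \<rho>) ^ N" for j \<rho>
  \<comment> \<open>The product of complements removes from the j-th locus all the earlier
    ones.\<close>
  define q where "q j \<rho> = b (s j) \<rho> ^ N * t j \<rho> ^ M * (\<Prod>i<j. 1 - e i \<rho>)" for j \<rho>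
  have t: "t j \<rho> \<in> ?S {\<rho>}" if "j < m" "\<rho> \<in> ?I" for j \<rho>
    unfolding t_def using s that by (intro transition_mem) auto
  have e: "e j \<rho> \<in> ?S {\<rho>}" if "j < m" "\<rho> \<in> ?I" for j \<rho>
  proof -
    interpret R: ring_ideal "?S {\<rho>}" "?S {\<rho>}" by (rule ring_ideal_UNIV)
    show ?thesis unfolding e_def using b s t that by (intro R.power_closed R.mult_closed) auto
  qed
  have prod_e: "(\<Prod>i<j. 1 - e i \<rho>) \<in> ?S {\<rho>}" if "j \<le> m" "\<rho> \<in> ?I" for j \<rho>
  proof -
    interpret R: ring_ideal "?S {\<rho>}" "?S {\<rho>}" by (rule ring_ideal_UNIV)
    show ?thesis using e that by (intro R.prod_closed R.diff_closed R.one_closed) auto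
  qed
  have q: "q j \<rho> \<in> ?S {\<rho>}" if "j < m" "\<rho> \<in> ?I" for j \<rho>
  proof -
    interpret R: ring_ideal "?S {\<rho>}" "?S {\<rho>}" by (rule ring_ideal_UNIV)
    show ?thesis unfolding q_def using b s t prod_e that by (intro R.power_closed R.mult_closed) auto
  qed
  have qt: "q j \<rho> * t j \<rho> ^ D = e j \<rho> * (\<Prod>i<j. 1 - e i \<rho>)" for j \<rho>
    by (simp add: q_def e_def N_def power_add power_mult_distrib mult_ac)
  \<comment> \<open>Modulo the ideal, \<open>t i \<rho> ^ M\<close> annihilates
    \<open>1 - e i \<rho>\<close>, a factor of the product as soon as i < j.\<close>
  have kill: "x * t i \<rho> ^ M * (\<Prod>i<j. 1 - e i \<rho>) \<in> Z \<rho>"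
    if "i < j" "j \<le> m" "\<rho> \<in> ?I" "x \<in> ?S {\<rho>}" for i j \<rho> x
  proof -
    interpret I: ring_ideal "?S {\<rho>}" "Z \<rho>" by (rule closed_subscheme_ring_ideal[OF cl that(3)])
    have "(\<Prod>i<j. 1 - e i \<rho>) = (1 - e i \<rho>) * (\<Prod>i\<in>{..<j} - {i}. 1 - e i \<rho>)"
      using that by (intro prod.remove) auto
    then have "x * t i \<rho> ^ M * (\<Prod>i<j. 1 - e i \<rho>) =
        x * (t i \<rho> ^ M * (1 - e i \<rho>) * (\<Prod>i\<in>{..<j} - {i}. 1 - e i \<rho>))"
      by (simp add: mult.assoc)
    moreover have "t i \<rho> ^ M * (1 - e i \<rho>) \<in> Z \<rho>"
      unfolding e_def t_def
      by (rule I.pi_regular_power[OF bM _ b order_refl]) (use s that t[of i \<rho>] in \<open>auto simp: t_def\<close>)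
    moreover have "(\<Prod>i\<in>{..<j} - {i}. 1 - e i \<rho>) \<in> ?S {\<rho>}"
      using e that by (intro I.prod_closed I.diff_closed I.one_closed) auto
    ultimately show ?thesis using I.mult_mem I.mult_mem_right that(4) by presburger
  qed
  show ?thesis
  proof (rule that)
    show "1 - (\<Sum>j<m. q j \<rho> * transition k (s j) \<rho> ^ D) \<in> Z \<rho>" if \<rho>: "\<rho> \<in> ?I" for \<rho>
    proof -
      \<comment> \<open>The chart \<rho> occurs among the \<open>s j\<close>, and there the
        transition function is 1; so the product of all complements lies in the ideal.\<close>
      obtain j where j: "j < m" "s j = \<rho>" using surj \<rho> by blast
      then have "t j \<rho> = 1" by (simp add: t_def transition_self)
      then have "(\<Prod>i<m. 1 - e i \<rho>) \<in> Z \<rho>"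
        using kill[OF j(1) order_refl \<rho> one_mem_line_bundle_sections] by simp
      moreover have "(\<Sum>j<m. q j \<rho> * transition k (s j) \<rho> ^ D) = 1 - (\<Prod>i<m. 1 - e i \<rho>)"
        using sum_prod_complement[of "\<lambda>j. e j \<rho>" m] by (simp add: qt flip: t_def)
      ultimately show ?thesis by simp
    qed
    show "q i \<rho> * transition k (s i) \<rho> ^ D * q j \<rho> \<in> Z \<rho>"
      if ij: "i < m" "j < m" "i \<noteq> j" and \<rho>: "\<rho> \<in> ?I" for i j \<rho>
    proof -
      interpret I: ring_ideal "?S {\<rho>}" "Z \<rho>" by (rule closed_subscheme_ring_ideal[OF cl \<rho>])
      note closed = I.mult_closed I.power_closed b s t prod_e \<rho>
      show ?thesis
      \<comment> \<open>The q with the larger index contains the complement of the idempotent with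
        the smaller index; the other q contributes the power of t that kills it.\<close>
      proof (cases "i < j")
        case True
        have "q i \<rho> * transition k (s i) \<rho> ^ D * q j \<rho> =
            (b (s i) \<rho> ^ N * t i \<rho> ^ D * (\<Prod>i<i. 1 - e i \<rho>) * (b (s j) \<rho> ^ N * t j \<rho> ^ M)) *
              t i \<rho> ^ M * (\<Prod>i<j. 1 - e i \<rho>)"
          by (simp add: q_def t_def mult_ac)
        also have "\<dots> \<in> Z \<rho>"
          by (rule kill[OF True _ \<rho>]) (use ij in \<open>auto intro!: closed\<close>)
        finally show ?thesis .
      next
        case False
        then have "j < i" using ij by simp
        have "q i \<rho> * transition k (s i) \<rho> ^ D * q j \<rho> =
            (b (s i) \<rho> ^ N * t i \<rho> ^ D * t i \<rho> ^ M * (b (s j) \<rho> ^ N * (\<Prod>i<j. 1 - e i \<rho>))) *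
              t j \<rho> ^ M * (\<Prod>i<i. 1 - e i \<rho>)"
          by (simp add: q_def t_def mult_ac)
        also have "\<dots> \<in> Z \<rho>"
          by (rule kill[OF \<open>j < i\<close> _ \<rho>]) (use ij in \<open>auto intro!: closed\<close>)
        finally show ?thesis .
      qed
    qed
    show "q j \<rho> - q j \<rho>' * transition k \<rho> \<rho>' ^ D \<in> ideal_sections k n Z {\<rho>, \<rho>'}"
      if j: "j < m" and \<rho>: "\<rho> \<in> ?I" "\<rho>' \<in> ?I" for j \<rho> \<rho>'
    proof -
      let ?J = "ideal_sections k n Z {\<rho>, \<rho>'}" and ?w = "transition k \<rho> \<rho>'" and ?w' = "transition k \<rho>' \<rho>"
      have sub: "{\<rho>, \<rho>'} \<subseteq> ?I" using \<rho> by simp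
      interpret I: ring_ideal "?S {\<rho>, \<rho>'}" ?J by (rule ideal_sections_ring_ideal[OF cl sub])
      have ZJ: "Z \<rho> \<subseteq> ?J" "Z \<rho>' \<subseteq> ?J"
        using chart_ideal_subset_ideal_sections[OF cl sub] by auto
      have S1: "?S {\<rho>} \<subseteq> ?S {\<rho>, \<rho>'}" and S2: "?S {\<rho>'} \<subseteq> ?S {\<rho>, \<rho>'}"
        by (intro line_bundle_sections_mono; simp)+
      have w: "?w \<in> ?S {\<rho>, \<rho>'}" "?w' \<in> ?S {\<rho>, \<rho>'}"
        using \<rho> by (auto intro!: transition_mem)
      have t': "t i \<rho>' = t i \<rho> * ?w" "t i \<rho> = t i \<rho>' * ?w'" for i
        by (simp_all add: t_def transition_mult)
      have ww: "?w * ?w' = 1" by (simp add: transition_mult transition_self)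
      \<comment> \<open>The quasi-inverse chosen on \<rho>', transported to one of
        \<open>t i \<rho>\<close>. It need not equal the one chosen on \<rho>, but
        \<open>pi_regular_unique\<close> compares the two.\<close>
      define c where "c i = b (s i) \<rho>' * ?w" for i
      have uniq: "t i \<rho> ^ K * b (s i) \<rho> ^ N - t i \<rho> ^ K * c i ^ N \<in> ?J" if "i < m" "M \<le> K" for i K
      proof (rule I.pi_regular_unique)
        show "t i \<rho> ^ M * (b (s i) \<rho> * t i \<rho> - 1) \<in> ?J"
          using bM[OF s \<rho>(1)] ZJ that by (auto simp: t_def)
        have "t i \<rho>' ^ M * (b (s i) \<rho>' * t i \<rho>' - 1) \<in> ?J"
          using bM[OF s \<rho>(2)] ZJ that by (auto simp: t_def)
        \<comment> \<open>On the overlap \<open>?w'\<close> is the inverse of \<open>?w\<close>; it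
          turns \<open>t i \<rho>'\<close> back into \<open>t i \<rho>\<close>.\<close>
        then have "?w' ^ M * (t i \<rho>' ^ M * (b (s i) \<rho>' * t i \<rho>' - 1)) \<in> ?J"
          using I.mult_mem[OF I.power_closed[OF w(2)]] by blast
        moreover have "?w' ^ M * (t i \<rho>' ^ M * (b (s i) \<rho>' * t i \<rho>' - 1)) =
            (t i \<rho>' * ?w') ^ M * (b (s i) \<rho>' * t i \<rho>' - 1)"
          by (simp add: power_mult_distrib mult_ac)
        moreover have "b (s i) \<rho>' * t i \<rho>' = c i * t i \<rho>"
          by (simp add: t'(1) c_def mult_ac)
        ultimately show "t i \<rho> ^ M * (c i * t i \<rho> - 1) \<in> ?J"
          by (simp flip: t'(2))
        show "b (s i) \<rho> \<in> ?S {\<rho>, \<rho>'}" using b s \<rho> that S1 by blast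
        show "c i \<in> ?S {\<rho>, \<rho>'}"
          unfolding c_def using b[OF s \<rho>(2)] that S2 w by (intro I.mult_closed) auto
        show "t i \<rho> \<in> ?S {\<rho>, \<rho>'}" using t \<rho> that S1 by blast
      qed (fact that)
      have "e i \<rho> - e i \<rho>' \<in> ?J" if "i < m" for i
      proof -
        have "e i \<rho>' = t i \<rho> ^ N * c i ^ N"
          by (simp add: e_def t'(1) c_def power_mult_distrib mult_ac)
        moreover have "e i \<rho> = t i \<rho> ^ N * b (s i) \<rho> ^ N"
          by (simp add: e_def power_mult_distrib mult_ac)
        ultimately show ?thesis using uniq[OF that, of N] by (simp add: N_def)
      qed
      then have e_cong: "(1 - e i \<rho>) - (1 - e i \<rho>') \<in> ?J" if "i < m" for i
        using I.uminus_mem that by fastforce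
      have e1: "1 - e i \<rho> \<in> ?S {\<rho>, \<rho>'}" "1 - e i \<rho>' \<in> ?S {\<rho>, \<rho>'}" if "i < m" for i
        using e that \<rho> S1 S2 by (auto intro!: I.diff_closed I.one_closed)
      have 1: "(\<Prod>i<j. 1 - e i \<rho>) - (\<Prod>i<j. 1 - e i \<rho>') \<in> ?J"
        using e_cong e1 j by (intro I.cong_prod) auto
      have 2: "t j \<rho> ^ M * c j ^ N \<in> ?S {\<rho>, \<rho>'}"
        unfolding c_def using t[OF j \<rho>(1)] b[OF s[OF j] \<rho>(2)] S1 S2 w
        by (intro I.mult_closed I.power_closed) auto
      have 3: "(\<Prod>i<j. 1 - e i \<rho>) \<in> ?S {\<rho>, \<rho>'}"
        using e1 j by (intro I.prod_closed) auto
      have "t j \<rho> ^ M * b (s j) \<rho> ^ N * (\<Prod>i<j. 1 - e i \<rho>) -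
          t j \<rho> ^ M * c j ^ N * (\<Prod>i<j. 1 - e i \<rho>') \<in> ?J"
        by (rule I.cong_mult[OF uniq[OF j order_refl] 1 2 3])
      \<comment> \<open>M factors of \<open>?w\<close> come from \<open>t j \<rho>' ^ M\<close> and
        D from the gluing factor; together they are the N factors needed to complete
        \<open>c j ^ N\<close>.\<close>
      moreover have "q j \<rho>' * ?w ^ D = t j \<rho> ^ M * c j ^ N * (\<Prod>i<j. 1 - e i \<rho>')"
        by (simp add: q_def t'(1) c_def N_def power_add power_mult_distrib mult_ac)
      moreover have "q j \<rho> = t j \<rho> ^ M * b (s j) \<rho> ^ N * (\<Prod>i<j. 1 - e i \<rho>)"
        by (simp add: q_def mult_ac)
      ultimately show ?thesis by simp
    qed
  qed (use s q in auto)
qed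

text \<open>\<open>\<theta>\<close> is a section over \<open>Z\<close> of the dual of the line bundle of multidegree \<open>d\<close> that vanishes
  nowhere: on the part of \<open>Z\<close> selected by the \<open>j\<close>-th idempotent it is the inverse of a monomial
  in the coordinates that are invertible on the chart \<open>s j\<close>.\<close>

lemma dual_line_bundle_trivialization:
  assumes Z: "zero_dim_scheme k n Z" and d: "\<And>i. i \<in> {1..k} \<Longrightarrow> 0 \<le> d i \<and> d i \<le> 1"
  obtains \<theta> where
    "\<And>\<rho>. \<rho> \<in> multi_indices k n \<Longrightarrow> \<theta> \<rho> \<in> line_bundle_sections k n (\<lambda>i. - d i) {\<rho>}"
    "\<And>\<rho> \<rho>'. \<rho> \<in> multi_indices k n \<Longrightarrow> \<rho>' \<in> multi_indices k n \<Longrightarrow>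
      \<theta> \<rho> - \<theta> \<rho>' \<in> twisted_ideal_sections k n Z (\<lambda>i. - d i) {\<rho>, \<rho>'}"
    "\<And>\<rho> g. \<rho> \<in> multi_indices k n \<Longrightarrow> g \<in> line_bundle_sections k n d {\<rho>} \<Longrightarrow>
      \<theta> \<rho> * g \<in> Z \<rho> \<Longrightarrow> g \<in> twisted_ideal_sections k n Z d {\<rho>}"
proof -
  let ?I = "multi_indices k n" and ?S = "\<lambda>\<tau>. line_bundle_sections k n (\<lambda>_. 0) \<tau>"
  let ?X = "coord_monomial k"
  note cl = zero_dim_closed[OF Z]
  obtain m :: nat and s q where s: "\<And>j. j < m \<Longrightarrow> s j \<in> ?I"
    and q: "\<And>j \<rho>. j < m \<Longrightarrow> \<rho> \<in> ?I \<Longrightarrow> q j \<rho> \<in> ?S {\<rho>}"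
    and total: "\<And>\<rho>. \<rho> \<in> ?I \<Longrightarrow> 1 - (\<Sum>j<m. q j \<rho> * transition k (s j) \<rho> ^ 1) \<in> Z \<rho>"
    and orth: "\<And>i j \<rho>. i < m \<Longrightarrow> j < m \<Longrightarrow> i \<noteq> j \<Longrightarrow> \<rho> \<in> ?I \<Longrightarrow>
      q i \<rho> * transition k (s i) \<rho> ^ 1 * q j \<rho> \<in> Z \<rho>"
    and glue: "\<And>j \<rho> \<rho>'. j < m \<Longrightarrow> \<rho> \<in> ?I \<Longrightarrow> \<rho>' \<in> ?I \<Longrightarrow>
      q j \<rho> - q j \<rho>' * transition k \<rho> \<rho>' ^ 1 \<in> ideal_sections k n Z {\<rho>, \<rho>'}"
    by (rule partition_of_unity[OF Z, of 1]) blast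
  \<comment> \<open>This is \<open>transition k (s j) \<rho>\<close> divided by the monomial of
    multidegree d at \<open>s j\<close>. Since d is at most 1, one transition factor clears all
    poles, whence the choice D = 1 above.\<close>
  define y where "y j \<rho> = ?X (\<lambda>i. 1 - d i) (s j) * ?X (\<lambda>_. - 1) \<rho>" for j \<rho>
  define \<theta> where "\<theta> \<rho> = (\<Sum>j<m. q j \<rho> * y j \<rho>)" for \<rho>
  have y: "y j \<rho> \<in> line_bundle_sections k n (\<lambda>i. - d i) \<tau>" if "j < m" "\<rho> \<in> ?I" "\<rho> \<in> \<tau>" for j \<rho> \<tau>
    unfolding y_def
    by (rule line_bundle_sections_mult'[OF coord_monomial_mem coord_monomial_mem_chart])
      (use that multi_indices_le[OF s] d in auto)
  show ?thesis
  proof (rule that)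
    fix \<rho> assume \<rho>: "\<rho> \<in> ?I"
    show "\<theta> \<rho> \<in> line_bundle_sections k n (\<lambda>i. - d i) {\<rho>}"
      unfolding \<theta>_def using q y \<rho>
      by (intro line_bundle_sections_sum line_bundle_sections_mult'[where d = "\<lambda>_. 0"]) auto
    {
      fix \<rho>' assume \<rho>': "\<rho>' \<in> ?I"
      have sub: "{\<rho>, \<rho>'} \<subseteq> ?I" "{\<rho>, \<rho>'} \<noteq> {}" using \<rho> \<rho>' by auto
      \<comment> \<open>The change of y between charts is inverse to that of q, so the products
        agree on overlaps modulo the ideal.\<close>
      have "y j \<rho>' = transition k \<rho> \<rho>' * y j \<rho>" for j
      proof -
        have "?X (\<lambda>_. 1) \<rho> * ?X (\<lambda>_. - 1) \<rho> = 1"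
          using coord_monomial_inverse(1)[of k "\<lambda>_. 1" \<rho>] by simp
        then have "y j \<rho>' = (?X (\<lambda>_. 1) \<rho> * ?X (\<lambda>_. - 1) \<rho>) * y j \<rho>'" by simp
        also have "\<dots> = transition k \<rho> \<rho>' * y j \<rho>"
          unfolding y_def transition_def by (simp only: mult_ac)
        finally show ?thesis .
      qed
      then have "\<theta> \<rho> - \<theta> \<rho>' = (\<Sum>j<m. y j \<rho> * (q j \<rho> - q j \<rho>' * transition k \<rho> \<rho>'))"
        unfolding \<theta>_def by (simp add: algebra_simps sum_subtractf)
      also have "\<dots> \<in> twisted_ideal_sections k n Z (\<lambda>i. - d i) {\<rho>, \<rho>'}"
      proof (intro twisted_ideal_sections_sum[OF cl sub])
        fix j assume "j \<in> {..<m}"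
        then have j: "j < m" by simp
        have *: "q j \<rho> - q j \<rho>' * transition k \<rho> \<rho>' \<in> twisted_ideal_sections k n Z (\<lambda>_. 0) {\<rho>, \<rho>'}"
          using glue[OF j \<rho> \<rho>'] twisted_ideal_sections_0[OF cl sub] by simp
        show "y j \<rho> * (q j \<rho> - q j \<rho>' * transition k \<rho> \<rho>') \<in>
            twisted_ideal_sections k n Z (\<lambda>i. - d i) {\<rho>, \<rho>'}"
          by (rule twisted_ideal_sections_mult[OF cl sub y *]) (use j \<rho> in auto)
      qed
      finally show "\<theta> \<rho> - \<theta> \<rho>' \<in> twisted_ideal_sections k n Z (\<lambda>i. - d i) {\<rho>, \<rho>'}" .
    next
      fix g assume g: "g \<in> line_bundle_sections k n d {\<rho>}" and g0: "\<theta> \<rho> * g \<in> Z \<rho>"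
      interpret I: ring_ideal "?S {\<rho>}" "Z \<rho>" by (rule closed_subscheme_ring_ideal[OF cl \<rho>])
      \<comment> \<open>Everything becomes a function on the chart: h stands for g and
        \<open>v j\<close> for \<open>y j \<rho>\<close>, \<open>\<epsilon> j\<close> is the j-th
        idempotent, and \<open>u j\<close> serves to undo \<open>v j\<close> up to the factor
        \<open>t j\<close>.\<close>
      define h where "h = g * ?X (\<lambda>i. - d i) \<rho>"
      define t where "t j = transition k (s j) \<rho>" for j
      define u where "u j = ?X d (s j) * ?X (\<lambda>i. - d i) \<rho>" for j
      define v where "v j = y j \<rho> * ?X d \<rho>" for j
      define \<epsilon> where "\<epsilon> j = q j \<rho> * t j" for j
      have h: "h \<in> ?S {\<rho>}"
        unfolding h_def by (rule line_bundle_sections_mult'[OF g coord_monomial_mem_chart]) (use \<rho> in auto)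
      have gh: "g = ?X d \<rho> * h"
        using coord_monomial_inverse(1)[of k d \<rho>] by (simp add: h_def mult.left_commute)
      have t: "t j \<in> ?S {\<rho>}" if "j < m" for j
        unfolding t_def using s \<rho> that by (intro transition_mem) auto
      have u: "u j \<in> ?S {\<rho>}" if "j < m" for j
        unfolding u_def
        by (rule line_bundle_sections_mult'[OF coord_monomial_mem coord_monomial_mem_chart])
          (use that multi_indices_le[OF s] d \<rho> in auto)
      have v: "v j \<in> ?S {\<rho>}" if "j < m" for j
        unfolding v_def by (rule line_bundle_sections_mult'[OF y coord_monomial_mem_chart]) (use that \<rho> in auto)
      have \<epsilon>: "\<epsilon> j \<in> ?S {\<rho>}" if "j < m" for j
        unfolding \<epsilon>_def using q \<rho> t that by (intro I.mult_closed) auto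
      have uv: "u j * v j = t j" for j
      proof -
        have "u j * v j = (?X d (s j) * ?X (\<lambda>i. 1 - d i) (s j)) * ?X (\<lambda>_. - 1) \<rho> *
            (?X d \<rho> * ?X (\<lambda>i. - d i) \<rho>)"
          by (simp only: u_def v_def y_def mult_ac)
        also have "\<dots> = t j"
          by (simp add: coord_monomial_inverse coord_monomial_mult[of k d _ "\<lambda>i. 1 - d i"] t_def transition_def)
        finally show ?thesis .
      qed
      have orth': "\<epsilon> i * q j \<rho> \<in> Z \<rho>" if "i < m" "j < m" "i \<noteq> j" for i j
        using orth[OF that \<rho>] by (simp add: \<epsilon>_def t_def)
      have \<theta>g: "\<theta> \<rho> * g = (\<Sum>j<m. q j \<rho> * v j * h)"
        unfolding \<theta>_def sum_distrib_right by (intro sum.cong) (simp_all add: gh v_def mult_ac)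
      have \<epsilon>h: "\<epsilon> i * h \<in> Z \<rho>" if i: "i < m" for i
      proof -
        \<comment> \<open>By orthogonality only the i-th summand survives modulo the ideal, and
          \<open>u i * v i = t i\<close> turns it into
          \<open>\<epsilon> i * \<epsilon> i * h\<close>.\<close>
        have "\<epsilon> i * u i * (\<theta> \<rho> * g) = (\<Sum>j<m. \<epsilon> i * q j \<rho> * (u i * v j * h))"
          unfolding \<theta>g sum_distrib_left by (intro sum.cong) (simp_all add: mult_ac)
        also have "\<dots> = \<epsilon> i * q i \<rho> * (u i * v i * h) +
            (\<Sum>j\<in>{..<m} - {i}. \<epsilon> i * q j \<rho> * (u i * v j * h))"
          using i by (intro sum.remove) auto
        finally have "\<epsilon> i * \<epsilon> i * h = \<epsilon> i * u i * (\<theta> \<rho> * g) -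
            (\<Sum>j\<in>{..<m} - {i}. \<epsilon> i * q j \<rho> * (u i * v j * h))"
          by (simp add: uv \<epsilon>_def mult_ac)
        moreover have "(\<Sum>j\<in>{..<m} - {i}. \<epsilon> i * q j \<rho> * (u i * v j * h)) \<in> Z \<rho>"
          by (rule I.sum_mem, rule I.mult_mem_right[OF orth'])
            (use i in \<open>auto intro!: I.mult_closed u v h\<close>)
        moreover have "\<epsilon> i * u i * (\<theta> \<rho> * g) \<in> Z \<rho>"
          using \<epsilon>[OF i] u[OF i] by (intro I.mult_mem[OF _ g0] I.mult_closed)
        ultimately have sq: "\<epsilon> i * \<epsilon> i * h \<in> Z \<rho>" using I.diff_mem by presburger
        \<comment> \<open>The square is removed because \<open>\<epsilon> i\<close> is idempotent
          modulo the ideal: multiply the total 1 by it and drop the cross terms.\<close>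
        have "(\<Sum>j<m. \<epsilon> j) = \<epsilon> i + (\<Sum>j\<in>{..<m} - {i}. \<epsilon> j)"
          using i by (intro sum.remove) auto
        then have eq: "\<epsilon> i * h = \<epsilon> i * h * (1 - (\<Sum>j<m. \<epsilon> j)) + \<epsilon> i * \<epsilon> i * h +
            (\<Sum>j\<in>{..<m} - {i}. \<epsilon> i * q j \<rho> * (t j * h))"
          by (simp add: algebra_simps sum_distrib_left \<epsilon>_def)
        have 1: "\<epsilon> i * h * (1 - (\<Sum>j<m. \<epsilon> j)) \<in> Z \<rho>"
          using total[OF \<rho>] \<epsilon>[OF i] h by (intro I.mult_mem I.mult_closed) (simp_all add: \<epsilon>_def t_def)
        have 2: "(\<Sum>j\<in>{..<m} - {i}. \<epsilon> i * q j \<rho> * (t j * h)) \<in> Z \<rho>"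
          by (rule I.sum_mem, rule I.mult_mem_right[OF orth'])
            (use i in \<open>auto intro!: I.mult_closed t h\<close>)
        show ?thesis by (subst eq) (intro I.add_mem 1 2 sq)
      qed
      have "h = (1 - (\<Sum>j<m. \<epsilon> j)) * h + (\<Sum>j<m. \<epsilon> j * h)"
        by (simp add: algebra_simps sum_distrib_left)
      moreover have "(1 - (\<Sum>j<m. \<epsilon> j)) * h \<in> Z \<rho>"
        using total[OF \<rho>] h by (intro I.mult_mem_right) (simp_all add: \<epsilon>_def t_def)
      moreover have "(\<Sum>j<m. \<epsilon> j * h) \<in> Z \<rho>"
        using \<epsilon>h by (intro I.sum_mem) auto
      ultimately have "h \<in> Z \<rho>" using I.add_mem by metis
      then show "g \<in> twisted_ideal_sections k n Z d {\<rho>}"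
        using \<rho> twisted_ideal_sections_iff[OF cl, of "{\<rho>}" \<rho>]
        by (simp add: h_def ideal_sections_chart[OF cl])
    }
  qed
qed

section \<open>Dimension counting and the Segre pairing\<close>

text \<open>The dimension counts sets, so the family must be injective: two equal members would give
  a vanishing combination with coefficients 1 and -1.\<close>

lemma quotient_dim_ge_family:
  assumes "finite I" and V: "\<And>i. i \<in> I \<Longrightarrow> v i \<in> V" and "(\<lambda>_. 0) \<in> W"
    and indep: "\<And>a. (\<lambda>x. \<Sum>i\<in>I. Poly_Mapping.single 0 (a i) * v i x) \<in> W \<Longrightarrow> \<forall>i\<in>I. a i = 0"
  shows "enat (card I) \<le> quotient_dim V W"
proof -
  have inj: "inj_on v I"
  proof
    fix i i' assume i: "i \<in> I" "i' \<in> I" "v i = v i'"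
    show "i = i'"
    proof (rule ccontr)
      assume ne: "i \<noteq> i'"
      define a where "a l = (if l = i then 1 else 0 :: complex) - (if l = i' then 1 else 0)" for l
      have "(\<Sum>l\<in>I. Poly_Mapping.single 0 (a l) * v l x) = 0" for x
      proof -
        have "(\<Sum>l\<in>I. Poly_Mapping.single 0 (a l) * v l x) =
            (\<Sum>l\<in>I. (if l = i then v l x else 0) - (if l = i' then v l x else 0))"
          by (intro sum.cong) (auto simp: a_def single_uminus)
        also have "\<dots> = 0"
          using assms(1) i by (simp add: sum_subtractf)
        finally show ?thesis .
      qed
      then have "a i = 0" using indep[of a] assms(3) i(1) by simp
      then show False using ne by (simp add: a_def)
    qed
  qed
  have "\<forall>f\<in>v ` I. a f = 0" if "(\<lambda>x. \<Sum>f\<in>v ` I. Poly_Mapping.single 0 (a f) * f x) \<in> W"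
    for a :: "_ \<Rightarrow> complex"
    using indep[of "\<lambda>i. a (v i)"] that by (simp add: sum.reindex[OF inj])
  moreover have "enat (card I) = enat (card (v ` I))"
    by (simp add: card_image[OF inj])
  ultimately show ?thesis
    unfolding quotient_dim_def using V assms(1) by (intro Sup_upper) blast
qed

text \<open>Otherwise f alone would be independent modulo W, as a nonzero coefficient can be scaled
  away by its inverse.\<close>

lemma quotient_dim_eq_0D:
  assumes dim: "quotient_dim V W = 0" and f: "f \<in> V" and zero: "(\<lambda>_. 0) \<in> W"
    and scale: "\<And>a g. g \<in> W \<Longrightarrow> (\<lambda>x. Poly_Mapping.single 0 a * g x) \<in> W"
  shows "f \<in> W"
proof (rule ccontr)
  assume "f \<notin> W"
  have "enat (card {()}) \<le> quotient_dim V W"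
  proof (rule quotient_dim_ge_family[where v = "\<lambda>_. f"])
    fix a :: "unit \<Rightarrow> complex"
    assume "(\<lambda>x. \<Sum>i\<in>{()}. Poly_Mapping.single 0 (a i) * f x) \<in> W"
    then have "(\<lambda>x. Poly_Mapping.single 0 (a ()) * f x) \<in> W" by simp
    then have "(\<lambda>x. Poly_Mapping.single 0 (inverse (a ())) * (Poly_Mapping.single 0 (a ()) * f x)) \<in> W"
      by (rule scale)
    moreover have "Poly_Mapping.single 0 (inverse b) * (Poly_Mapping.single 0 b * y) = y"
      if "b \<noteq> 0" for b and y :: laurent
      using that by (simp add: mult_single flip: mult.assoc)
    ultimately show "\<forall>i\<in>{()}. a i = 0" using \<open>f \<notin> W\<close> by force
  qed (use f zero in auto)
  then show False using dim by (simp add: zero_enat_def)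
qed

lemma lookup_scale:
  "Poly_Mapping.lookup (Poly_Mapping.single 0 a * f) m = a * Poly_Mapping.lookup (f :: laurent) m"
  by (simp add: map.rep_eq when_def flip: mult_map_scale_conv_mult)

text \<open>Rank-nullity for the map \<open>g \<mapsto> \<theta> * g\<close> from the span of the monomials in \<open>Q\<close> to \<open>V / W\<close>:
  a maximal set of monomials with independent images has at most \<open>c\<close> elements, and each other
  monomial is congruent modulo the kernel to a combination of these.\<close>

lemma kernel_family:
  fixes Q :: "exponent set" and \<theta> :: "'a \<Rightarrow> laurent"
  assumes Q: "finite Q" and V: "\<And>m. m \<in> Q \<Longrightarrow> (\<lambda>x. \<theta> x * Poly_Mapping.single m 1) \<in> V"
    and dim: "quotient_dim V W \<le> enat c" and zero: "(\<lambda>_. 0) \<in> W"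
    and scale: "\<And>a g. g \<in> W \<Longrightarrow> (\<lambda>x. Poly_Mapping.single 0 a * g x) \<in> W"
  obtains Q' and p :: "exponent \<Rightarrow> laurent" where "finite Q'" "card Q \<le> card Q' + c"
    "\<And>m. m \<in> Q' \<Longrightarrow> Poly_Mapping.keys (p m) \<subseteq> Q" "\<And>m. m \<in> Q' \<Longrightarrow> (\<lambda>x. \<theta> x * p m) \<in> W"
    "\<And>b. (\<Sum>m\<in>Q'. Poly_Mapping.single 0 (b m) * p m) = 0 \<Longrightarrow> \<forall>m\<in>Q'. b m = (0::complex)"
proof -
  define comb where "comb a S x = (\<Sum>m\<in>S. Poly_Mapping.single 0 (a m) * (\<theta> x * Poly_Mapping.single m 1))"
    for a :: "exponent \<Rightarrow> complex" and S x
  define indep where "indep S \<longleftrightarrow> S \<subseteq> Q \<and> (\<forall>a. comb a S \<in> W \<longrightarrow> (\<forall>m\<in>S. a m = 0))" for S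
  have "indep {}" by (simp add: indep_def)
  moreover have card_le: "card S \<le> c" if "indep S" for S
  proof -
    have "enat (card S) \<le> quotient_dim V W"
    proof (rule quotient_dim_ge_family[where v = "\<lambda>m x. \<theta> x * Poly_Mapping.single m 1"])
      show "finite S" using that Q finite_subset by (auto simp: indep_def)
      show "\<forall>i\<in>S. a i = 0"
        if "(\<lambda>x. \<Sum>i\<in>S. Poly_Mapping.single 0 (a i) * (\<theta> x * Poly_Mapping.single i 1)) \<in> W" for a
        using that \<open>indep S\<close> by (simp add: indep_def comb_def[abs_def])
    qed (use V that zero in \<open>auto simp: indep_def\<close>)
    then have "enat (card S) \<le> enat c" using dim by (rule order.trans)
    then show ?thesis by simp
  qed
  ultimately have "\<exists>S. indep S \<and> (\<forall>S'. indep S' \<longrightarrow> card S' \<le> card S)"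
    by (intro ex_has_greatest_nat[of indep "{}" card "Suc c"]) (simp_all add: le_imp_less_Suc)
  then obtain S where S: "indep S" and max: "\<And>S'. indep S' \<Longrightarrow> card S' \<le> card S"
    by metis
  have SQ: "S \<subseteq> Q" and finS: "finite S"
    using S Q finite_subset by (auto simp: indep_def)
  \<comment> \<open>Maximality of S yields a relation, and independence of S makes its coefficient
    at m nonzero; it is normalized to 1.\<close>
  have "\<exists>a. comb a (insert m S) \<in> W \<and> a m = 1" if m: "m \<in> Q - S" for m
  proof -
    have "\<not> indep (insert m S)"
      using max[of "insert m S"] m finS by auto
    then obtain a where a: "comb a (insert m S) \<in> W" "\<exists>m'\<in>insert m S. a m' \<noteq> 0"
      using m SQ by (auto simp: indep_def)
    have "a m \<noteq> 0"
    proof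
      assume "a m = 0"
      then have "comb a (insert m S) = comb a S" using m finS by (auto simp: comb_def)
      then show False using a S \<open>a m = 0\<close> by (auto simp: indep_def)
    qed
    have "comb (\<lambda>m'. inverse (a m) * a m') (insert m S) =
        (\<lambda>x. Poly_Mapping.single 0 (inverse (a m)) * comb a (insert m S) x)"
    proof -
      have "Poly_Mapping.single 0 (b * b') = (Poly_Mapping.single 0 b * Poly_Mapping.single 0 b' :: laurent)"
        for b b'
        by (simp add: mult_single)
      then show ?thesis by (simp add: comb_def[abs_def] sum_distrib_left mult.assoc)
    qed
    then show ?thesis
      using scale[OF a(1)] \<open>a m \<noteq> 0\<close> by (intro exI[of _ "\<lambda>m'. inverse (a m) * a m'"]) simp
  qed
  then obtain a where a: "\<And>m. m \<in> Q - S \<Longrightarrow> comb (a m) (insert m S) \<in> W"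
    "\<And>m. m \<in> Q - S \<Longrightarrow> a m m = 1"
    by metis
  \<comment> \<open>Each \<open>p m\<close> is the monomial m plus a combination of S, so m occurs
    in no other \<open>p l\<close>; comparing coefficients at m proves independence.\<close>
  define p where "p m = (\<Sum>m'\<in>insert m S. Poly_Mapping.single m' (a m m'))" for m
  have lookup_p: "Poly_Mapping.lookup (p m) l = (if l \<in> insert m S then a m l else 0)" for m l
    using finS by (simp add: p_def lookup_sum lookup_single when_def del: sum.insert)
  show ?thesis
  proof (rule that)
    show "finite (Q - S)" using Q by simp
    show "card Q \<le> card (Q - S) + c"
      using card_Diff_subset[OF finS SQ] card_le[OF S] by linarith
    show "Poly_Mapping.keys (p m) \<subseteq> Q" if "m \<in> Q - S" for m
      using that SQ by (auto simp: in_keys_iff lookup_p split: if_splits)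
    show "(\<lambda>x. \<theta> x * p m) \<in> W" if "m \<in> Q - S" for m
    proof -
      have "\<theta> x * p m = comb (a m) (insert m S) x" for x
        unfolding p_def comb_def sum_distrib_left
        by (intro sum.cong) (simp_all add: mult.left_commute[of _ "\<theta> x"] mult_single)
      then have "(\<lambda>x. \<theta> x * p m) = comb (a m) (insert m S)" by blast
      then show ?thesis using a(1)[OF that] by simp
    qed
    show "\<forall>m\<in>Q - S. b m = 0" if eq: "(\<Sum>m\<in>Q - S. Poly_Mapping.single 0 (b m) * p m) = 0" for b
    proof
      fix m assume m: "m \<in> Q - S"
      have "0 = (\<Sum>l\<in>Q - S. Poly_Mapping.lookup (Poly_Mapping.single 0 (b l) * p l) m)"
        using arg_cong[OF eq, of "\<lambda>f. Poly_Mapping.lookup f m"] by (simp add: lookup_sum)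
      also have "\<dots> = (\<Sum>l\<in>Q - S. b l * Poly_Mapping.lookup (p l) m)"
        by (simp add: lookup_scale)
      also have "\<dots> = (\<Sum>l\<in>Q - S. if l = m then b m else 0)"
        using m a(2) by (intro sum.cong) (auto simp: lookup_p)
      also have "\<dots> = b m" using m Q by simp
      finally show "b m = 0" by simp
    qed
  qed
qed

section \<open>Linear forms on the Segre target and forms of multidegree (1, ..., 1)\<close>

lemma segre_monomial_eq: "segre_monomial k \<alpha> = coord_monomial k (\<lambda>_. 1) \<alpha>"
proof -
  have "(\<Prod>i\<in>I. Poly_Mapping.single (f i) 1) = (Poly_Mapping.single (sum f I) 1 :: laurent)"
    if "finite I" for I :: "nat set" and f
    using that by induction (simp_all add: mult_single)
  then show ?thesis
    by (simp add: segre_monomial_def coord_monomial_def coord_exponent_def)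
qed

text \<open>For i in F, the value \<open>\<alpha> i\<close> is recovered as the only j at which
  \<open>x(i,j)\<close> has a nonzero exponent.\<close>

lemma coord_exponent_inj_on:
  assumes "F \<subseteq> {1..k}" "\<And>i. i \<in> F \<Longrightarrow> d i \<noteq> 0"
  shows "inj_on (coord_exponent k d) (\<Pi>\<^sub>E i\<in>F. A i)"
proof
  fix \<alpha> \<beta> assume *: "\<alpha> \<in> (\<Pi>\<^sub>E i\<in>F. A i)" "\<beta> \<in> (\<Pi>\<^sub>E i\<in>F. A i)"
    "coord_exponent k d \<alpha> = coord_exponent k d \<beta>"
  show "\<alpha> = \<beta>"
  proof (rule PiE_ext[OF *(1,2)])
    fix i assume i: "i \<in> F"
    then have "Poly_Mapping.lookup (coord_exponent k d \<alpha>) (i, \<alpha> i) \<noteq> 0"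
      using assms by (auto simp: lookup_coord_exponent)
    then show "\<alpha> i = \<beta> i"
      unfolding *(3) by (simp add: lookup_coord_exponent split: if_splits)
  qed
qed

text \<open>In each factor the exponents are nonnegative integers with sum 1, hence a unit vector;
  the positions of the ones form the index.\<close>

lemma multidegree_one_exponent:
  assumes keys: "Poly_Mapping.keys m \<subseteq> cox_vars k n"
    and deg: "\<And>i. i \<in> {1..k} \<Longrightarrow> multidegree n m i = 1"
    and nonneg: "\<And>i j. 0 \<le> Poly_Mapping.lookup m (i, j)"
  shows "m \<in> coord_exponent k (\<lambda>_. 1) ` multi_indices k n"
proof -
  have "\<exists>j\<in>{0..n i}. Poly_Mapping.lookup m (i, j) = 1 \<and>
      (\<forall>j'\<in>{0..n i} - {j}. Poly_Mapping.lookup m (i, j') = 0)" if i: "i \<in> {1..k}" for i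
  proof -
    have sum: "(\<Sum>j=0..n i. Poly_Mapping.lookup m (i, j)) = 1"
      using deg[OF i] by (simp add: multidegree_def)
    then obtain j where j: "j \<in> {0..n i}" "Poly_Mapping.lookup m (i, j) \<noteq> 0"
      by (metis (no_types, lifting) sum.neutral zero_neq_one)
    have "(\<Sum>j'\<in>{0..n i} - {j}. Poly_Mapping.lookup m (i, j')) = 1 - Poly_Mapping.lookup m (i, j)"
      using sum j(1) by (subst (asm) sum.remove[of _ j]) auto
    moreover have "0 \<le> (\<Sum>j'\<in>{0..n i} - {j}. Poly_Mapping.lookup m (i, j'))"
      by (intro sum_nonneg nonneg)
    moreover have "1 \<le> Poly_Mapping.lookup m (i, j)" using j(2) nonneg[of i j] by linarith
    ultimately have "Poly_Mapping.lookup m (i, j) = 1"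
      and "(\<Sum>j'\<in>{0..n i} - {j}. Poly_Mapping.lookup m (i, j')) = 0"
      by linarith+
    then show ?thesis
      using j(1) nonneg by (subst (asm) sum_nonneg_eq_0_iff) auto
  qed
  then obtain J where J: "\<And>i. i \<in> {1..k} \<Longrightarrow> J i \<in> {0..n i}"
    "\<And>i. i \<in> {1..k} \<Longrightarrow> Poly_Mapping.lookup m (i, J i) = 1"
    "\<And>i j. i \<in> {1..k} \<Longrightarrow> j \<in> {0..n i} - {J i} \<Longrightarrow> Poly_Mapping.lookup m (i, j) = 0"
    by metis
  define \<alpha> where "\<alpha> = restrict J {1..k}"
  have \<alpha>: "\<alpha> \<in> multi_indices k n"
    unfolding \<alpha>_def multi_indices_def using J(1) by simp
  have "m = coord_exponent k (\<lambda>_. 1) \<alpha>"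
  proof (rule poly_mapping_eqI)
    fix p :: "nat \<times> nat"
    obtain i j where p: "p = (i, j)" by fastforce
    show "Poly_Mapping.lookup m p = Poly_Mapping.lookup (coord_exponent k (\<lambda>_. 1) \<alpha>) p"
    proof (cases "i \<in> {1..k} \<and> j \<in> {0..n i}")
      case True
      then show ?thesis
        using J(2,3) by (cases "j = J i") (simp_all add: p lookup_coord_exponent \<alpha>_def)
    next
      case False
      then have "(i, j) \<notin> Poly_Mapping.keys m" using keys by (auto simp: cox_vars_def)
      moreover have "\<not> (i \<in> {1..k} \<and> j = \<alpha> i)" using False J(1) by (auto simp: \<alpha>_def)
      ultimately show ?thesis by (simp add: p lookup_coord_exponent in_keys_iff)
    qed
  qed
  then show ?thesis using \<alpha> by blast
qed

text \<open>The point T as a linear functional with value \<open>T \<alpha>\<close> on the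
  coordinate \<open>z(\<alpha>)\<close>. Monomials other than Segre monomials are ignored, so it is
  total and linear on all Laurent polynomials.\<close>

definition segre_eval :: "nat \<Rightarrow> (nat \<Rightarrow> nat) \<Rightarrow> ((nat \<Rightarrow> nat) \<Rightarrow> complex) \<Rightarrow> laurent \<Rightarrow> complex" where
  "segre_eval k n T f =
    (\<Sum>\<alpha>\<in>multi_indices k n. Poly_Mapping.lookup f (coord_exponent k (\<lambda>_. 1) \<alpha>) * T \<alpha>)"

lemma segre_eval_add: "segre_eval k n T (f + g) = segre_eval k n T f + segre_eval k n T g"
  by (simp add: segre_eval_def lookup_add sum.distrib distrib_right)

lemma lookup_segre_pullback:
  "Poly_Mapping.lookup (segre_pullback k n l) m =
    (\<Sum>\<alpha>\<in>multi_indices k n. if m = coord_exponent k (\<lambda>_. 1) \<alpha> then l \<alpha> else 0)"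
  by (auto simp: segre_pullback_def segre_monomial_eq coord_monomial_def mult_single lookup_sum
      lookup_single when_def intro!: sum.cong)

lemma lookup_segre_pullback_coord_exponent:
  assumes "\<alpha> \<in> multi_indices k n"
  shows "Poly_Mapping.lookup (segre_pullback k n l) (coord_exponent k (\<lambda>_. 1) \<alpha>) = l \<alpha>"
proof -
  have inj: "inj_on (coord_exponent k (\<lambda>_. 1)) (multi_indices k n)"
    unfolding multi_indices_def by (rule coord_exponent_inj_on) auto
  have "Poly_Mapping.lookup (segre_pullback k n l) (coord_exponent k (\<lambda>_. 1) \<alpha>) =
      (\<Sum>\<beta>\<in>multi_indices k n. if \<beta> = \<alpha> then l \<alpha> else 0)"
    unfolding lookup_segre_pullback
    by (intro sum.cong) (use assms inj_onD[OF inj] in auto)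
  then show ?thesis using assms finite_multi_indices by simp
qed

lemma segre_eval_pullback:
  "segre_eval k n T (segre_pullback k n l) = (\<Sum>\<alpha>\<in>multi_indices k n. l \<alpha> * T \<alpha>)"
  by (simp add: segre_eval_def lookup_segre_pullback_coord_exponent)

text \<open>Without poles all exponents are nonnegative, so every monomial of f is a Segre monomial.
  Hence conditions on hyperplanes become conditions on forms.\<close>

lemma segre_pullback_lookup:
  assumes f: "f \<in> line_bundle_sections k n (\<lambda>_. 1) {}"
  shows "segre_pullback k n (\<lambda>\<alpha>. Poly_Mapping.lookup f (coord_exponent k (\<lambda>_. 1) \<alpha>)) = f"
proof (rule poly_mapping_eqI)
  fix m
  let ?l = "\<lambda>\<alpha>. Poly_Mapping.lookup f (coord_exponent k (\<lambda>_. 1) \<alpha>)"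
  show "Poly_Mapping.lookup (segre_pullback k n ?l) m = Poly_Mapping.lookup f m"
  proof (cases "m \<in> coord_exponent k (\<lambda>_. 1) ` multi_indices k n")
    case True
    then show ?thesis by (auto simp: lookup_segre_pullback_coord_exponent)
  next
    case False
    have "m \<notin> Poly_Mapping.keys f"
    proof
      assume m: "m \<in> Poly_Mapping.keys f"
      have "0 \<le> Poly_Mapping.lookup m (i, j)" for i j
        using line_bundle_sectionsD(3)[OF f m, of i j] by force
      then show False
        using False multidegree_one_exponent line_bundle_sectionsD(1,2)[OF f m] by blast
    qed
    moreover have "Poly_Mapping.lookup (segre_pullback k n ?l) m = 0"
      unfolding lookup_segre_pullback by (intro sum.neutral) (use False in auto)
    ultimately show ?thesis by (simp add: in_keys_iff)
  qed
qed

lemma segre_spanD: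
  assumes "T \<in> segre_span k n Z" "f \<in> line_bundle_sections k n (\<lambda>_. 1) {}"
    and "\<And>\<sigma>. \<sigma> \<in> multi_indices k n \<Longrightarrow> f \<in> twisted_ideal_sections k n Z (\<lambda>_. 1) {\<sigma>}"
  shows "segre_eval k n T f = 0"
  using assms segre_pullback_lookup[OF assms(2)]
  by (simp add: segre_span_def hyperplane_contains_def segre_eval_def)

lemma segre_spanI:
  assumes "\<exists>\<alpha>\<in>multi_indices k n. T \<alpha> \<noteq> 0"
    and "\<And>f. (\<And>\<sigma>. \<sigma> \<in> multi_indices k n \<Longrightarrow> f \<in> twisted_ideal_sections k n Z (\<lambda>_. 1) {\<sigma>}) \<Longrightarrow>
      segre_eval k n T f = 0"
  shows "T \<in> segre_span k n Z"
  using assms segre_eval_pullback unfolding segre_span_def hyperplane_contains_def by force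

section \<open>Cohomology and hypersurface sections\<close>

text \<open>Exactness of global sections on Y, global sections on Z, first cohomology of the twisted
  ideal sheaf: a section over Z lifts to Y because its image under the connecting map
  vanishes.\<close>

lemma h1_eq_0_lift:
  assumes cl: "closed_subscheme k n Z" and h1: "h_ideal k n 1 Z u = 0"
    and s: "\<And>\<rho>. \<rho> \<in> multi_indices k n \<Longrightarrow> s \<rho> \<in> line_bundle_sections k n (indicator u) {\<rho>}"
    and glue: "\<And>\<rho> \<rho>'. \<rho> \<in> multi_indices k n \<Longrightarrow> \<rho>' \<in> multi_indices k n \<Longrightarrow>
      s \<rho> - s \<rho>' \<in> twisted_ideal_sections k n Z (indicator u) {\<rho>, \<rho>'}"
  obtains v where "v \<in> line_bundle_sections k n (indicator u) {}"
    "\<And>\<rho>. \<rho> \<in> multi_indices k n \<Longrightarrow> v - s \<rho> \<in> twisted_ideal_sections k n Z (indicator u) {\<rho>}"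
proof -
  let ?I = "multi_indices k n" and ?d = "indicator u :: nat \<Rightarrow> int"
  \<comment> \<open>The connecting map: differences of local lifts form a cocycle with values in the
    twisted ideal.\<close>
  define c where "c l = s (l ! 1) - s (l ! 0)" for l
  have c: "c \<in> cocycles k n Z ?d 1"
    unfolding cocycles_def cochains_def
  proof (intro CollectI conjI ballI)
    fix l assume "l \<in> simplices k n 1"
    then obtain \<sigma> \<rho> where "l = [\<sigma>, \<rho>]" "\<sigma> \<in> ?I" "\<rho> \<in> ?I"
      by (auto simp: simplices_def numeral_2_eq_2 length_Suc_conv)
    then show "c l \<in> twisted_ideal_sections k n Z ?d (set l)"
      using glue[of \<rho> \<sigma>] by (simp add: c_def insert_commute)
  next
    fix l assume "l \<in> simplices k n (1 + 1)"
    then obtain \<sigma> \<rho> \<tau> where "l = [\<sigma>, \<rho>, \<tau>]"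
      by (auto simp: simplices_def numeral_3_eq_3 length_Suc_conv)
    then show "cech_diff c l = 0"
      by (simp add: cech_diff_def c_def numeral_3_eq_3 lessThan_Suc)
  qed
  have "c \<in> coboundaries k n Z ?d 1"
  proof (rule quotient_dim_eq_0D[OF h1[unfolded h_ideal_def] c])
    have "(\<lambda>_. 0) \<in> cochains k n Z ?d 0"
      unfolding cochains_def simplices_def
      by (auto intro!: twisted_ideal_sections_zero[OF cl])
    then show "(\<lambda>_. 0) \<in> coboundaries k n Z ?d 1"
      by (auto simp: coboundaries_def cech_diff_def intro!: bexI[of _ "\<lambda>_. 0"])
    fix a :: complex and g assume "g \<in> coboundaries k n Z ?d 1"
    then obtain b where b: "b \<in> cochains k n Z ?d 0" "\<forall>l\<in>simplices k n 1. g l = cech_diff b l"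
      by (auto simp: coboundaries_def)
    have "(\<lambda>l. Poly_Mapping.single 0 a * b l) \<in> cochains k n Z ?d 0"
      using b(1) unfolding cochains_def simplices_def
      by (auto intro!: twisted_ideal_sections_scale[OF cl])
    moreover have "\<forall>l\<in>simplices k n 1. Poly_Mapping.single 0 a * g l =
        cech_diff (\<lambda>l. Poly_Mapping.single 0 a * b l) l"
      using b(2) by (simp add: cech_diff_def sum_distrib_left mult.left_commute)
    ultimately show "(\<lambda>l. Poly_Mapping.single 0 a * g l) \<in> coboundaries k n Z ?d 1"
      by (auto simp: coboundaries_def)
  qed
  then obtain b where b: "b \<in> cochains k n Z ?d 0" "\<forall>l\<in>simplices k n 1. c l = cech_diff b l"
    by (auto simp: coboundaries_def)
  have b0: "b [\<rho>] \<in> twisted_ideal_sections k n Z ?d {\<rho>}" if "\<rho> \<in> ?I" for \<rho>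
  proof -
    have "[\<rho>] \<in> simplices k n 0" using that by (simp add: simplices_def)
    then show ?thesis using b(1) by (fastforce simp: cochains_def)
  qed
  have b1: "s \<rho> - s \<sigma> = b [\<rho>] - b [\<sigma>]" if "\<sigma> \<in> ?I" "\<rho> \<in> ?I" for \<sigma> \<rho>
  proof -
    have "[\<sigma>, \<rho>] \<in> simplices k n 1" using that by (simp add: simplices_def)
    then have "c [\<sigma>, \<rho>] = cech_diff b [\<sigma>, \<rho>]" using b(2) by blast
    then show ?thesis by (simp add: c_def cech_diff_def numeral_2_eq_2 lessThan_Suc)
  qed
  obtain \<sigma>0 where \<sigma>0: "\<sigma>0 \<in> ?I" using multi_indices_nonempty by blast
  \<comment> \<open>After correction by b the local lifts coincide as Laurent polynomials, so any
    chart may define v.\<close>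
  define v where "v = s \<sigma>0 - b [\<sigma>0]"
  have v: "v = s \<rho> - b [\<rho>]" if "\<rho> \<in> ?I" for \<rho>
    using b1[OF \<sigma>0 that] by (simp add: v_def algebra_simps)
  show ?thesis
  proof (rule that)
    show "v \<in> line_bundle_sections k n ?d {}"
    proof (rule line_bundle_sections_global)
      fix \<rho> assume \<rho>: "\<rho> \<in> ?I"
      then have "b [\<rho>] \<in> line_bundle_sections k n ?d {\<rho>}"
        using b0[OF \<rho>] by (intro twisted_ideal_sections_subset[OF cl]) auto
      then show "v \<in> line_bundle_sections k n ?d {\<rho>}"
        unfolding v[OF \<rho>] using s[OF \<rho>] by (intro line_bundle_sections_diff)
    qed (simp add: indicator_def)
    fix \<rho> assume \<rho>: "\<rho> \<in> ?I"
    have "0 - b [\<rho>] \<in> twisted_ideal_sections k n Z ?d {\<rho>}"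
      using b0[OF \<rho>] \<rho> by (intro twisted_ideal_sections_diff[OF cl] twisted_ideal_sections_zero[OF cl]) auto
    then show "v - s \<rho> \<in> twisted_ideal_sections k n Z ?d {\<rho>}"
      by (simp add: v[OF \<rho>])
  qed
qed

text \<open>A form lying in the twisted ideal on every chart is a constant cocycle. Coboundaries in
  degree 0 vanish on charts, so independence can be tested on a single one.\<close>

lemma h0_ge_family:
  assumes "finite I"
    and p: "\<And>m \<rho>. m \<in> I \<Longrightarrow> \<rho> \<in> multi_indices k n \<Longrightarrow>
      p m \<in> twisted_ideal_sections k n Z (indicator u) {\<rho>}"
    and indep: "\<And>b. (\<Sum>m\<in>I. Poly_Mapping.single 0 (b m) * p m) = 0 \<Longrightarrow> \<forall>m\<in>I. b m = 0"
  shows "enat (card I) \<le> h_ideal k n 0 Z u"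
  unfolding h_ideal_def
proof (rule quotient_dim_ge_family[where v = "\<lambda>m _. p m"])
  fix m assume m: "m \<in> I"
  show "(\<lambda>_. p m) \<in> cocycles k n Z (indicator u) 0"
    unfolding cocycles_def cochains_def
  proof (intro CollectI conjI ballI)
    fix l assume "l \<in> simplices k n 0"
    then obtain \<sigma> where "l = [\<sigma>]" "\<sigma> \<in> multi_indices k n"
      by (auto simp: simplices_def length_Suc_conv)
    then show "p m \<in> twisted_ideal_sections k n Z (indicator u) (set l)"
      using p[OF m] by simp
  next
    fix l assume "l \<in> simplices k n (0 + 1)"
    then show "cech_diff (\<lambda>_. p m) l = 0"
      by (simp add: simplices_def cech_diff_def numeral_2_eq_2 lessThan_Suc)
  qed
next
  fix a assume *: "(\<lambda>x. \<Sum>i\<in>I. Poly_Mapping.single 0 (a i) * p i) \<in> coboundaries k n Z (indicator u) 0"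
  obtain \<sigma> where "\<sigma> \<in> multi_indices k n" using multi_indices_nonempty by blast
  then have "[\<sigma>] \<in> simplices k n 0" by (simp add: simplices_def)
  then have "(\<Sum>i\<in>I. Poly_Mapping.single 0 (a i) * p i) = 0"
    using * by (auto simp: coboundaries_def)
  then show "\<forall>i\<in>I. a i = 0" by (rule indep)
qed (use assms(1) in \<open>auto simp: coboundaries_def\<close>)

section \<open>The subscheme cut out by a form\<close>

definition hypersurface_section ::
  "nat \<Rightarrow> (nat \<Rightarrow> nat) \<Rightarrow> ideal_data \<Rightarrow> (nat \<Rightarrow> int) \<Rightarrow> laurent \<Rightarrow> ideal_data" where
  "hypersurface_section k n Z d g \<rho> =
    {a + r * (g * coord_monomial k (\<lambda>i. - d i) \<rho>) | a r.
      a \<in> Z \<rho> \<and> r \<in> line_bundle_sections k n (\<lambda>_. 0) {\<rho>}}"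

context
  fixes k :: nat and n :: "nat \<Rightarrow> nat" and Z :: ideal_data and d :: "nat \<Rightarrow> int" and g :: laurent
  assumes cl: "closed_subscheme k n Z" and g: "g \<in> line_bundle_sections k n d {}"
begin

text \<open>The form g is a section of a line bundle; its quotient by the generator on a chart is a
  function and serves as local equation.\<close>

lemma local_equation_mem:
  "\<rho> \<in> multi_indices k n \<Longrightarrow> g * coord_monomial k (\<lambda>i. - d i) \<rho> \<in> line_bundle_sections k n (\<lambda>_. 0) {\<rho>}"
  by (rule line_bundle_sections_mult'[OF line_bundle_sections_mono_mem[OF g] coord_monomial_mem_chart]) auto

lemma hypersurface_section_ring_ideal:
  "\<rho> \<in> multi_indices k n \<Longrightarrow>
    ring_ideal (line_bundle_sections k n (\<lambda>_. 0) {\<rho>}) (hypersurface_section k n Z d g \<rho>)"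
  unfolding hypersurface_section_def
  by (intro ring_ideal.ring_ideal_add_principal closed_subscheme_ring_ideal[OF cl] local_equation_mem)

lemma subset_hypersurface_section: "Z \<rho> \<subseteq> hypersurface_section k n Z d g \<rho>"
proof
  fix a assume "a \<in> Z \<rho>"
  then show "a \<in> hypersurface_section k n Z d g \<rho>"
    unfolding hypersurface_section_def
    by (intro CollectI exI[of _ a] exI[of _ 0]) (simp add: line_bundle_sections_0)
qed

lemma local_equation_mem_hypersurface_section:
  assumes "\<rho> \<in> multi_indices k n"
  shows "g * coord_monomial k (\<lambda>i. - d i) \<rho> \<in> hypersurface_section k n Z d g \<rho>"
  unfolding hypersurface_section_def
  by (intro CollectI exI[of _ 0] exI[of _ 1])
    (simp add: one_mem_line_bundle_sections ring_ideal.zero_mem[OF closed_subscheme_ring_ideal[OF cl assms]])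

text \<open>The local equations of two charts differ by a quotient of generators, which is a
  function on the overlap. One inclusion suffices, since the charts can be interchanged.\<close>

lemma hypersurface_section_glue:
  assumes \<sigma>: "\<sigma> \<in> multi_indices k n" and \<rho>: "\<rho> \<in> multi_indices k n"
  shows "genideal (coord_ring k n {\<sigma>, \<rho>}) (hypersurface_section k n Z d g \<sigma>) \<subseteq>
    genideal (coord_ring k n {\<sigma>, \<rho>}) (hypersurface_section k n Z d g \<rho>)"
    (is "?G \<sigma> \<subseteq> ?G \<rho>")
proof -
  let ?S = "\<lambda>\<tau>. line_bundle_sections k n (\<lambda>_. 0) \<tau>"
  have S: "?S {\<sigma>} \<subseteq> ?S {\<sigma>, \<rho>}" "?S {\<rho>} \<subseteq> ?S {\<sigma>, \<rho>}"
    by (intro line_bundle_sections_mono; simp)+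
  have sub: "hypersurface_section k n Z d g \<sigma> \<subseteq> ?S {\<sigma>, \<rho>}" "hypersurface_section k n Z d g \<rho> \<subseteq> ?S {\<sigma>, \<rho>}"
    using ring_ideal.subset[OF hypersurface_section_ring_ideal[OF \<sigma>]]
      ring_ideal.subset[OF hypersurface_section_ring_ideal[OF \<rho>]] S by blast+
  interpret G: ring_ideal "?S {\<sigma>, \<rho>}" "?G \<rho>" by (rule genideal_coord_ring(1)[OF sub(2)])
  have in_G: "hypersurface_section k n Z d g \<rho> \<subseteq> ?G \<rho>" by (rule genideal_coord_ring(2)[OF sub(2)])
  have sub': "Z \<sigma> \<subseteq> ?S {\<sigma>, \<rho>}" "Z \<rho> \<subseteq> ?S {\<sigma>, \<rho>}"
    using sub subset_hypersurface_section by blast+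
  have "genideal (coord_ring k n {\<sigma>, \<rho>}) (Z \<rho>) \<subseteq> ?G \<rho>"
    using in_G subset_hypersurface_section by (intro genideal_coord_ring(3)[OF sub'(2) G.ring_ideal_axioms]) blast
  then have ZG: "Z \<sigma> \<subseteq> ?G \<rho>"
    using genideal_coord_ring(2)[OF sub'(1)] cl \<sigma> \<rho> unfolding closed_subscheme_def by blast
  have "g * coord_monomial k (\<lambda>i. - d i) \<sigma> =
      (coord_monomial k d \<rho> * coord_monomial k (\<lambda>i. - d i) \<sigma>) * (g * coord_monomial k (\<lambda>i. - d i) \<rho>)"
  proof -
    have "(coord_monomial k d \<rho> * coord_monomial k (\<lambda>i. - d i) \<sigma>) * (g * coord_monomial k (\<lambda>i. - d i) \<rho>) =
        (coord_monomial k d \<rho> * coord_monomial k (\<lambda>i. - d i) \<rho>) * (g * coord_monomial k (\<lambda>i. - d i) \<sigma>)"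
      by (simp only: mult_ac)
    then show ?thesis by (simp add: coord_monomial_inverse)
  qed
  also have "\<dots> \<in> ?G \<rho>"
  proof (rule G.mult_mem)
    show "coord_monomial k d \<rho> * coord_monomial k (\<lambda>i. - d i) \<sigma> \<in> ?S {\<sigma>, \<rho>}"
      by (rule line_bundle_sections_mult'[OF coord_monomial_mem_chart coord_monomial_mem_chart])
        (use \<sigma> \<rho> in auto)
    show "g * coord_monomial k (\<lambda>i. - d i) \<rho> \<in> ?G \<rho>"
      using local_equation_mem_hypersurface_section[OF \<rho>] in_G by blast
  qed
  finally have eq: "g * coord_monomial k (\<lambda>i. - d i) \<sigma> \<in> ?G \<rho>" .
  have "hypersurface_section k n Z d g \<sigma> \<subseteq> ?G \<rho>"
  proof
    fix x assume "x \<in> hypersurface_section k n Z d g \<sigma>"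
    then obtain a r where "x = a + r * (g * coord_monomial k (\<lambda>i. - d i) \<sigma>)" "a \<in> Z \<sigma>" "r \<in> ?S {\<sigma>}"
      unfolding hypersurface_section_def by blast
    then show "x \<in> ?G \<rho>" using ZG S(1) eq G.add_mem G.mult_mem by blast
  qed
  then show ?thesis by (intro genideal_coord_ring(3)[OF sub(1) G.ring_ideal_axioms])
qed

lemma closed_hypersurface_section: "closed_subscheme k n (hypersurface_section k n Z d g)"
  unfolding closed_subscheme_def ideal_coord_ring_iff
proof (intro conjI ballI hypersurface_section_ring_ideal)
  fix \<sigma> \<rho> assume "\<sigma> \<in> multi_indices k n" "\<rho> \<in> multi_indices k n"
  then show "genideal (coord_ring k n {\<sigma>, \<rho>}) (hypersurface_section k n Z d g \<sigma>) =
      genideal (coord_ring k n {\<sigma>, \<rho>}) (hypersurface_section k n Z d g \<rho>)"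
    using hypersurface_section_glue[of \<sigma> \<rho>] hypersurface_section_glue[of \<rho> \<sigma>]
    by (simp add: insert_commute)
qed

lemma proper_hypersurface_section:
  assumes \<rho>: "\<rho> \<in> multi_indices k n" and "g \<notin> twisted_ideal_sections k n Z d {\<rho>}"
  shows "proper_subscheme k n (hypersurface_section k n Z d g) Z"
proof -
  have "g * coord_monomial k (\<lambda>i. - d i) \<rho> \<notin> Z \<rho>"
    using assms twisted_ideal_sections_iff[OF cl, of "{\<rho>}" \<rho>]
    by (simp add: ideal_sections_chart[OF cl])
  then show ?thesis
    unfolding proper_subscheme_def
    using closed_hypersurface_section subset_hypersurface_section
      local_equation_mem_hypersurface_section[OF \<rho>] \<rho> by blast
qed

text \<open>In the trivialization at \<rho>, f is an element of \<open>Z \<rho>\<close> plus r times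
  the local equation; restoring the degrees turns r into the quotient w.\<close>

lemma twisted_hypersurface_sectionE:
  assumes \<rho>: "\<rho> \<in> multi_indices k n"
    and f: "f \<in> twisted_ideal_sections k n (hypersurface_section k n Z d g) e {\<rho>}"
    and ed: "\<And>i. i \<in> {1..k} \<Longrightarrow> d' i + d i = e i"
  shows "\<exists>w\<in>line_bundle_sections k n d' {\<rho>}. f - w * g \<in> twisted_ideal_sections k n Z e {\<rho>}"
proof -
  have "f * coord_monomial k (\<lambda>i. - e i) \<rho> \<in> hypersurface_section k n Z d g \<rho>"
    using f \<rho> twisted_ideal_sections_iff[OF closed_hypersurface_section, of "{\<rho>}" \<rho>]
    by (simp add: ideal_sections_chart[OF closed_hypersurface_section])
  then obtain a r where ar: "f * coord_monomial k (\<lambda>i. - e i) \<rho> = a + r * (g * coord_monomial k (\<lambda>i. - d i) \<rho>)"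
    "a \<in> Z \<rho>" "r \<in> line_bundle_sections k n (\<lambda>_. 0) {\<rho>}"
    unfolding hypersurface_section_def by blast
  define w where "w = r * coord_monomial k (\<lambda>i. e i - d i) \<rho>"
  have "w \<in> line_bundle_sections k n d' {\<rho>}"
    unfolding w_def using ed
    by (intro line_bundle_sections_mult'[OF ar(3) coord_monomial_mem_chart[OF \<rho>]]) force+
  moreover have "(f - w * g) * coord_monomial k (\<lambda>i. - e i) \<rho> = a"
  proof -
    have "coord_monomial k (\<lambda>i. e i - d i) \<rho> * coord_monomial k (\<lambda>i. - e i) \<rho> = coord_monomial k (\<lambda>i. - d i) \<rho>"
      by (simp add: coord_monomial_mult)
    then have "w * g * coord_monomial k (\<lambda>i. - e i) \<rho> = r * (g * coord_monomial k (\<lambda>i. - d i) \<rho>)"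
      by (simp add: w_def mult_ac)
    then show ?thesis using ar(1) by (simp add: left_diff_distrib)
  qed
  ultimately show ?thesis
    using ar(2) \<rho> twisted_ideal_sections_iff[OF cl, of "{\<rho>}" \<rho>]
    by (auto simp: ideal_sections_chart[OF cl])
qed

end

text \<open>Over the zero-dimensional scheme \<open>Z\<close>, local quotients of \<open>f\<close> by \<open>g\<close> can be glued. They are
  unique only up to the annihilator of \<open>g\<close>, so this needs the partition of unity.\<close>

lemma glue_local_quotients:
  assumes Z: "zero_dim_scheme k n Z" and ed: "\<And>i. i \<in> {1..k} \<Longrightarrow> d' i + d i = e i"
    and w: "\<And>\<rho>. \<rho> \<in> multi_indices k n \<Longrightarrow> w \<rho> \<in> line_bundle_sections k n d' {\<rho>}"
    and f: "\<And>\<rho>. \<rho> \<in> multi_indices k n \<Longrightarrow> f \<in> line_bundle_sections k n e {\<rho>}"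
    and fw: "\<And>\<rho>. \<rho> \<in> multi_indices k n \<Longrightarrow> f - w \<rho> * g \<in> twisted_ideal_sections k n Z e {\<rho>}"
  obtains s where
    "\<And>\<rho>. \<rho> \<in> multi_indices k n \<Longrightarrow> s \<rho> \<in> line_bundle_sections k n d' {\<rho>}"
    "\<And>\<rho> \<rho>'. \<rho> \<in> multi_indices k n \<Longrightarrow> \<rho>' \<in> multi_indices k n \<Longrightarrow>
      s \<rho> - s \<rho>' \<in> twisted_ideal_sections k n Z d' {\<rho>, \<rho>'}"
    "\<And>\<rho>. \<rho> \<in> multi_indices k n \<Longrightarrow> f - s \<rho> * g \<in> twisted_ideal_sections k n Z e {\<rho>}"
proof -
  let ?I = "multi_indices k n" and ?S = "\<lambda>\<tau>. line_bundle_sections k n (\<lambda>_. 0) \<tau>"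
  note cl = zero_dim_closed[OF Z]
  have "\<forall>\<^sub>F D in sequentially. transition k \<sigma> \<rho> ^ D * w \<sigma> \<in> line_bundle_sections k n d' {\<rho>} \<and>
      transition k \<sigma> \<rho> ^ D * (f - w \<sigma> * g) \<in> twisted_ideal_sections k n Z e {\<rho>}"
    if "\<sigma> \<in> ?I" "\<rho> \<in> ?I" for \<sigma> \<rho>
  proof (rule eventually_conj)
    have "w \<sigma> \<in> line_bundle_sections k n d' {\<sigma>, \<rho>}"
      by (rule line_bundle_sections_mono_mem[OF w[OF that(1)]]) simp
    then show "\<forall>\<^sub>F D in sequentially. transition k \<sigma> \<rho> ^ D * w \<sigma> \<in> line_bundle_sections k n d' {\<rho>}"
      by (rule transition_power_clears_poles[OF _ that])
    show "\<forall>\<^sub>F D in sequentially. transition k \<sigma> \<rho> ^ D * (f - w \<sigma> * g) \<in> twisted_ideal_sections k n Z e {\<rho>}"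
      by (rule twisted_ideal_sections_clear_poles[OF cl that fw[OF that(1)]])
  qed
  then have "\<forall>\<^sub>F D in sequentially. \<forall>\<sigma>\<in>?I. \<forall>\<rho>\<in>?I.
      transition k \<sigma> \<rho> ^ D * w \<sigma> \<in> line_bundle_sections k n d' {\<rho>} \<and>
      transition k \<sigma> \<rho> ^ D * (f - w \<sigma> * g) \<in> twisted_ideal_sections k n Z e {\<rho>}"
    by (simp add: eventually_ball_finite finite_multi_indices)
  \<comment> \<open>As there are finitely many charts, one power extends each
    \<open>w \<sigma>\<close> to all charts and carries its relation to f along.\<close>
  then obtain D where D: "\<And>\<sigma> \<rho>. \<sigma> \<in> ?I \<Longrightarrow> \<rho> \<in> ?I \<Longrightarrow>
      transition k \<sigma> \<rho> ^ D * w \<sigma> \<in> line_bundle_sections k n d' {\<rho>}"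
    "\<And>\<sigma> \<rho>. \<sigma> \<in> ?I \<Longrightarrow> \<rho> \<in> ?I \<Longrightarrow>
      transition k \<sigma> \<rho> ^ D * (f - w \<sigma> * g) \<in> twisted_ideal_sections k n Z e {\<rho>}"
    using eventually_happens'[OF sequentially_bot] by blast
  obtain m :: nat and c q where c: "\<And>j. j < m \<Longrightarrow> c j \<in> ?I"
    and q: "\<And>j \<rho>. j < m \<Longrightarrow> \<rho> \<in> ?I \<Longrightarrow> q j \<rho> \<in> ?S {\<rho>}"
    and total: "\<And>\<rho>. \<rho> \<in> ?I \<Longrightarrow> 1 - (\<Sum>j<m. q j \<rho> * transition k (c j) \<rho> ^ D) \<in> Z \<rho>"
    and glue: "\<And>j \<rho> \<rho>'. j < m \<Longrightarrow> \<rho> \<in> ?I \<Longrightarrow> \<rho>' \<in> ?I \<Longrightarrow>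
      q j \<rho> - q j \<rho>' * transition k \<rho> \<rho>' ^ D \<in> ideal_sections k n Z {\<rho>, \<rho>'}"
    by (rule partition_of_unity[OF Z, of D]) blast
  \<comment> \<open>On the part of Z selected by the j-th idempotent, the quotient from the chart
    \<open>c j\<close> is used. The same \<open>w (c j)\<close> enters on every chart, so gluing
    reduces to that of q.\<close>
  define s where "s \<rho> = (\<Sum>j<m. q j \<rho> * (transition k (c j) \<rho> ^ D * w (c j)))" for \<rho>
  show ?thesis
  proof (rule that)
    fix \<rho> assume \<rho>: "\<rho> \<in> ?I"
    show "s \<rho> \<in> line_bundle_sections k n d' {\<rho>}"
      unfolding s_def
      by (rule line_bundle_sections_sum, rule line_bundle_sections_mult'[OF q D(1)[OF c]]) (use \<rho> in auto)
    {
      fix \<rho>' assume \<rho>': "\<rho>' \<in> ?I"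
      have sub: "{\<rho>, \<rho>'} \<subseteq> ?I" "{\<rho>, \<rho>'} \<noteq> {}" using \<rho> \<rho>' by auto
      have "s \<rho> - s \<rho>' = (\<Sum>j<m. (transition k (c j) \<rho> ^ D * w (c j)) *
          (q j \<rho> - q j \<rho>' * transition k \<rho> \<rho>' ^ D))"
        unfolding s_def sum_subtractf[symmetric]
      proof (intro sum.cong refl)
        fix j
        have "transition k (c j) \<rho>' ^ D = transition k (c j) \<rho> ^ D * transition k \<rho> \<rho>' ^ D"
          by (simp add: transition_mult flip: power_mult_distrib)
        then show "q j \<rho> * (transition k (c j) \<rho> ^ D * w (c j)) -
            q j \<rho>' * (transition k (c j) \<rho>' ^ D * w (c j)) =
            transition k (c j) \<rho> ^ D * w (c j) * (q j \<rho> - q j \<rho>' * transition k \<rho> \<rho>' ^ D)"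
          by (simp add: algebra_simps)
      qed
      also have "\<dots> \<in> twisted_ideal_sections k n Z d' {\<rho>, \<rho>'}"
      proof (intro twisted_ideal_sections_sum[OF cl sub])
        fix j assume "j \<in> {..<m}"
        then have j: "j < m" by simp
        have 1: "q j \<rho> - q j \<rho>' * transition k \<rho> \<rho>' ^ D \<in> twisted_ideal_sections k n Z (\<lambda>_. 0) {\<rho>, \<rho>'}"
          using glue[OF j \<rho> \<rho>'] twisted_ideal_sections_0[OF cl sub] by simp
        have 2: "transition k (c j) \<rho> ^ D * w (c j) \<in> line_bundle_sections k n d' {\<rho>, \<rho>'}"
          by (rule line_bundle_sections_mono_mem[OF D(1)[OF c[OF j] \<rho>]]) simp
        show "transition k (c j) \<rho> ^ D * w (c j) * (q j \<rho> - q j \<rho>' * transition k \<rho> \<rho>' ^ D) \<in>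
            twisted_ideal_sections k n Z d' {\<rho>, \<rho>'}"
          by (rule twisted_ideal_sections_mult[OF cl sub 2 1]) simp
      qed
      finally show "s \<rho> - s \<rho>' \<in> twisted_ideal_sections k n Z d' {\<rho>, \<rho>'}" .
    next
      have sub: "{\<rho>} \<subseteq> ?I" "{\<rho>} \<noteq> {}" using \<rho> by auto
      define \<epsilon> where "\<epsilon> j = q j \<rho> * transition k (c j) \<rho> ^ D" for j
      have sg: "s \<rho> * g = (\<Sum>j<m. \<epsilon> j * (w (c j) * g))"
        unfolding s_def sum_distrib_right by (intro sum.cong) (simp_all add: \<epsilon>_def mult_ac)
      \<comment> \<open>The factor 1 of f is replaced by the sum of the idempotents, with error in
        the ideal; then each summand involves only one local quotient.\<close>
      have "f - s \<rho> * g = f * (1 - (\<Sum>j<m. \<epsilon> j)) + (\<Sum>j<m. \<epsilon> j * (f - w (c j) * g))"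
        unfolding sg right_diff_distrib sum_subtractf sum_distrib_right[symmetric] by (simp add: mult.commute)
      also have "\<dots> \<in> twisted_ideal_sections k n Z e {\<rho>}"
      proof (intro twisted_ideal_sections_add[OF cl sub] twisted_ideal_sections_sum[OF cl sub])
        have 1: "1 - (\<Sum>j<m. \<epsilon> j) \<in> twisted_ideal_sections k n Z (\<lambda>_. 0) {\<rho>}"
          using total[OF \<rho>] by (simp add: twisted_ideal_sections_0_chart[OF cl \<rho>] \<epsilon>_def)
        show "f * (1 - (\<Sum>j<m. \<epsilon> j)) \<in> twisted_ideal_sections k n Z e {\<rho>}"
          by (rule twisted_ideal_sections_mult[OF cl sub f[OF \<rho>] 1]) simp
        fix j assume "j \<in> {..<m}"
        then have j: "j < m" by simp
        show "\<epsilon> j * (f - w (c j) * g) \<in> twisted_ideal_sections k n Z e {\<rho>}"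
          unfolding \<epsilon>_def mult.assoc
          by (rule twisted_ideal_sections_mult[OF cl sub q[OF j \<rho>] D(2)[OF c[OF j] \<rho>]]) simp
      qed
      finally show "f - s \<rho> * g \<in> twisted_ideal_sections k n Z e {\<rho>}" .
    }
  qed
qed

text \<open>If \<open>g\<close> did not vanish on \<open>A\<close>, then \<open>T\<close> would be in the span of the proper subscheme of \<open>A\<close>
  cut out by \<open>g\<close>: a form \<open>f\<close> vanishing there agrees on \<open>A\<close> with \<open>v * g\<close> for some form \<open>v\<close>.\<close>

lemma kernel_vanishes:
  assumes A: "zero_dim_scheme k n A" and h1: "h_ideal k n 1 A E = 0"
    and T: "T \<in> segre_span k n A"
    and minimal: "\<And>A'. proper_subscheme k n A' A \<Longrightarrow> T \<notin> segre_span k n A'"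
    and EF: "E \<union> F = {1..k}" "E \<inter> F = {}"
    and g: "g \<in> line_bundle_sections k n (indicator F) {}"
    and ker: "\<And>v. v \<in> line_bundle_sections k n (indicator E) {} \<Longrightarrow> segre_eval k n T (v * g) = 0"
    and \<rho>: "\<rho> \<in> multi_indices k n"
  shows "g \<in> twisted_ideal_sections k n A (indicator F) {\<rho>}"
proof (rule ccontr)
  let ?I = "multi_indices k n" and ?A' = "hypersurface_section k n A (indicator F) g"
  let ?E = "indicator E :: nat \<Rightarrow> int"
  assume not_mem: "\<not> ?thesis"
  note cl = zero_dim_closed[OF A]
  have ed: "?E i + indicator F i = 1" if "i \<in> {1..k}" for i
    using EF that by (auto simp: indicator_def)
  have "T \<in> segre_span k n ?A'"
  proof (rule segre_spanI)
    show "\<exists>\<alpha>\<in>?I. T \<alpha> \<noteq> 0" using T by (simp add: segre_span_def)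
    fix f assume f: "\<And>\<sigma>. \<sigma> \<in> ?I \<Longrightarrow> f \<in> twisted_ideal_sections k n ?A' (\<lambda>_. 1) {\<sigma>}"
    have f1: "f \<in> line_bundle_sections k n (\<lambda>_. 1) {\<sigma>}" if "\<sigma> \<in> ?I" for \<sigma>
      using twisted_ideal_sections_subset[OF closed_hypersurface_section[OF cl g] _ _ f[OF that]] that by simp
    have "\<forall>\<sigma>\<in>?I. \<exists>w\<in>line_bundle_sections k n ?E {\<sigma>}. f - w * g \<in> twisted_ideal_sections k n A (\<lambda>_. 1) {\<sigma>}"
      using twisted_hypersurface_sectionE[OF cl g _ f] ed by blast
    then obtain w where w1: "\<And>\<sigma>. \<sigma> \<in> ?I \<Longrightarrow> w \<sigma> \<in> line_bundle_sections k n ?E {\<sigma>}"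
      and w2: "\<And>\<sigma>. \<sigma> \<in> ?I \<Longrightarrow> f - w \<sigma> * g \<in> twisted_ideal_sections k n A (\<lambda>_. 1) {\<sigma>}"
      by metis
    obtain s where s: "\<And>\<sigma>. \<sigma> \<in> ?I \<Longrightarrow> s \<sigma> \<in> line_bundle_sections k n ?E {\<sigma>}"
      "\<And>\<sigma> \<tau>. \<sigma> \<in> ?I \<Longrightarrow> \<tau> \<in> ?I \<Longrightarrow> s \<sigma> - s \<tau> \<in> twisted_ideal_sections k n A ?E {\<sigma>, \<tau>}"
      "\<And>\<sigma>. \<sigma> \<in> ?I \<Longrightarrow> f - s \<sigma> * g \<in> twisted_ideal_sections k n A (\<lambda>_. 1) {\<sigma>}"
      by (rule glue_local_quotients[OF A ed w1 f1 w2]) (assumption | rule that)+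
    obtain v where v: "v \<in> line_bundle_sections k n ?E {}"
      "\<And>\<sigma>. \<sigma> \<in> ?I \<Longrightarrow> v - s \<sigma> \<in> twisted_ideal_sections k n A ?E {\<sigma>}"
      by (rule h1_eq_0_lift[OF cl h1 s(1,2)]) (assumption | rule that)+
    have "segre_eval k n T (f - v * g) = 0"
    proof (rule segre_spanD[OF T])
      show "f - v * g \<in> line_bundle_sections k n (\<lambda>_. 1) {}"
        using line_bundle_sections_mult'[OF v(1) g ed] line_bundle_sections_global[OF f1]
        by (intro line_bundle_sections_diff) simp_all
      fix \<sigma> assume \<sigma>: "\<sigma> \<in> ?I"
      have sub: "{\<sigma>} \<subseteq> ?I" "{\<sigma>} \<noteq> {}" using \<sigma> by auto
      \<comment> \<open>\<open>f - v * g\<close> is \<open>f - s \<sigma> * g\<close> minus this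
        product, so it vanishes on A.\<close>
      have "g * (v - s \<sigma>) \<in> twisted_ideal_sections k n A (\<lambda>_. 1) {\<sigma>}"
        by (rule twisted_ideal_sections_mult[OF cl sub line_bundle_sections_mono_mem[OF g] v(2)[OF \<sigma>]])
          (use ed in \<open>auto simp: add.commute\<close>)
      from twisted_ideal_sections_diff[OF cl sub s(3)[OF \<sigma>] this]
      show "f - v * g \<in> twisted_ideal_sections k n A (\<lambda>_. 1) {\<sigma>}"
        by (simp add: algebra_simps)
    qed
    then show "segre_eval k n T f = 0"
      using segre_eval_add[of k n T "f - v * g" "v * g"] ker[OF v(1)] by simp
  qed
  then show False
    using minimal[OF proper_hypersurface_section[OF cl g \<rho> not_mem]] by contradiction
qed

theorem theorem3p1:
  fixes k h c :: nat and n :: "nat \<Rightarrow> nat" and E F :: "nat set"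
    and A :: ideal_data and T :: "(nat \<Rightarrow> nat) \<Rightarrow> complex"
  assumes "E \<union> F = {1..k}" and "E \<inter> F = {}"
    and "card E = k - h" and "card F = h" and "0 < h" and "h < k"
    and "0 < c" and "c < (\<Prod>i\<in>F. (n i + 1))"
    and "zero_dim_scheme k n A"
    and "h_ideal k n 1 A E = 0"
    and "h_ideal k n 0 A F < enat ((\<Prod>i\<in>F. (n i + 1)) - c)"
    and "T \<in> segre_span k n A"
    and "\<And>A'. proper_subscheme k n A' A \<Longrightarrow> T \<notin> segre_span k n A'"
  shows "\<not> (\<exists>B. zero_dim_scheme k n B \<and> scheme_degree k n B \<le> enat c \<and>
                T \<in> segre_span k n B)"
proof
  let ?I = "multi_indices k n" and ?F = "indicator F :: nat \<Rightarrow> int" and ?E = "indicator E :: nat \<Rightarrow> int"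
  assume "\<exists>B. zero_dim_scheme k n B \<and> scheme_degree k n B \<le> enat c \<and> T \<in> segre_span k n B"
  then obtain B where B: "zero_dim_scheme k n B" "scheme_degree k n B \<le> enat c" "T \<in> segre_span k n B"
    by blast
  note cl = zero_dim_closed[OF B(1)]
  have F: "F \<subseteq> {1..k}" "finite F" using assms(1) finite_subset[of F "{1..k}"] by auto
  have ed: "?E i + ?F i = 1" if "i \<in> {1..k}" for i
    using assms(1,2) that by (auto simp: indicator_def)
  \<comment> \<open>The monomial basis of the forms of multidegree F, as many as the affine
    dimension of the Segre target of the factors in F.\<close>
  define Q where "Q = coord_exponent k ?F ` (\<Pi>\<^sub>E i\<in>F. {0..n i})"
  have "card Q = (\<Prod>i\<in>F. n i + 1)"
    unfolding Q_def using F coord_exponent_inj_on[OF F(1), of ?F]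
    by (subst card_image) (auto simp: card_PiE)
  have "finite Q" unfolding Q_def using F by (intro finite_imageI finite_PiE) auto
  have Q: "Poly_Mapping.single m 1 \<in> line_bundle_sections k n ?F \<tau>" if m: "m \<in> Q" for m \<tau>
  proof -
    obtain \<beta> where \<beta>: "\<beta> \<in> (\<Pi>\<^sub>E i\<in>F. {0..n i})" "m = coord_exponent k ?F \<beta>" using m Q_def by blast
    have "coord_monomial k ?F \<beta> \<in> line_bundle_sections k n ?F \<tau>"
      using \<beta>(1) by (intro coord_monomial_mem) (auto simp: indicator_def split: if_splits)
    then show ?thesis by (simp add: coord_monomial_def \<beta>(2))
  qed
  have span_Q: "f \<in> line_bundle_sections k n ?F \<tau>" if "Poly_Mapping.keys f \<subseteq> Q" for f \<tau>
  proof -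
    have "\<forall>m\<in>Poly_Mapping.keys f. Poly_Mapping.single m 1 \<in> line_bundle_sections k n ?F \<tau>"
      using that Q by blast
    then show ?thesis unfolding line_bundle_sections_def by simp
  qed
  \<comment> \<open>Multiplication by \<theta> turns forms of multidegree F into global functions on
    B, a space of dimension at most c, and loses no information about vanishing on B.\<close>
  obtain \<theta> where \<theta>: "\<And>\<rho>. \<rho> \<in> ?I \<Longrightarrow> \<theta> \<rho> \<in> line_bundle_sections k n (\<lambda>i. - ?F i) {\<rho>}"
    "\<And>\<rho> \<rho>'. \<rho> \<in> ?I \<Longrightarrow> \<rho>' \<in> ?I \<Longrightarrow> \<theta> \<rho> - \<theta> \<rho>' \<in> twisted_ideal_sections k n B (\<lambda>i. - ?F i) {\<rho>, \<rho>'}"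
    "\<And>\<rho> g. \<rho> \<in> ?I \<Longrightarrow> g \<in> line_bundle_sections k n ?F {\<rho>} \<Longrightarrow> \<theta> \<rho> * g \<in> B \<rho> \<Longrightarrow>
      g \<in> twisted_ideal_sections k n B ?F {\<rho>}"
    by (rule dual_line_bundle_trivialization[OF B(1), of ?F]) (auto simp: indicator_def)
  let ?V = "{f. (\<forall>\<sigma>\<in>?I. f \<sigma> \<in> carrier (coord_ring k n {\<sigma>})) \<and>
      (\<forall>\<sigma>\<in>?I. \<forall>\<rho>\<in>?I. f \<sigma> - f \<rho> \<in> ideal_sections k n B {\<sigma>, \<rho>})}"
    and ?W = "{f. \<forall>\<sigma>\<in>?I. f \<sigma> \<in> B \<sigma>}"
  have V: "(\<lambda>\<rho>. \<theta> \<rho> * Poly_Mapping.single m 1) \<in> ?V" if m: "m \<in> Q" for m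
  proof (intro CollectI conjI ballI)
    let ?m = "Poly_Mapping.single m (1::complex)"
    show "\<theta> \<sigma> * ?m \<in> carrier (coord_ring k n {\<sigma>})" if "\<sigma> \<in> ?I" for \<sigma>
      using line_bundle_sections_mult'[OF \<theta>(1)[OF that] Q[OF m]] by (simp add: coord_ring_def)
    fix \<sigma> \<rho> assume *: "\<sigma> \<in> ?I" "\<rho> \<in> ?I"
    then have sub: "{\<sigma>, \<rho>} \<subseteq> ?I" "{\<sigma>, \<rho>} \<noteq> {}" by auto
    have "?m * (\<theta> \<sigma> - \<theta> \<rho>) \<in> twisted_ideal_sections k n B (\<lambda>_. 0) {\<sigma>, \<rho>}"
      by (rule twisted_ideal_sections_mult[OF cl sub Q[OF m] \<theta>(2)[OF *]]) simp
    then show "\<theta> \<sigma> * ?m - \<theta> \<rho> * ?m \<in> ideal_sections k n B {\<sigma>, \<rho>}"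
      by (simp add: twisted_ideal_sections_0[OF cl sub] algebra_simps)
  qed
  have zero: "(\<lambda>_. 0) \<in> ?W"
    using closed_subscheme_ring_ideal[OF cl] ring_ideal.zero_mem by blast
  have scale: "(\<lambda>x. Poly_Mapping.single 0 a * g x) \<in> ?W" if "g \<in> ?W" for a g
    using that closed_subscheme_ring_ideal[OF cl] ring_ideal.mult_mem const_mem_line_bundle_sections
    by blast
  \<comment> \<open>By rank-nullity, at least \<open>card Q - c\<close> independent forms vanish on
    B.\<close>
  obtain Q' and p :: "exponent \<Rightarrow> laurent" where Q': "finite Q'" "card Q \<le> card Q' + c"
    and p: "\<And>m. m \<in> Q' \<Longrightarrow> Poly_Mapping.keys (p m) \<subseteq> Q" "\<And>m. m \<in> Q' \<Longrightarrow> (\<lambda>\<rho>. \<theta> \<rho> * p m) \<in> ?W"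
    and indep: "\<And>b. (\<Sum>m\<in>Q'. Poly_Mapping.single 0 (b m) * p m) = 0 \<Longrightarrow> \<forall>m\<in>Q'. b m = (0::complex)"
    by (rule kernel_family[OF \<open>finite Q\<close> V B(2)[unfolded scheme_degree_def] zero scale]) (assumption | rule that)+
  have "enat (card Q') \<le> h_ideal k n 0 A F"
  proof (rule h0_ge_family[OF Q'(1) _ indep])
    fix m \<rho> assume m: "m \<in> Q'" and \<rho>: "\<rho> \<in> ?I"
    show "p m \<in> twisted_ideal_sections k n A ?F {\<rho>}"
    proof (rule kernel_vanishes[OF assms(9,10,12) assms(13) assms(1,2) span_Q[OF p(1)[OF m]] _ \<rho>])
      \<comment> \<open>The product vanishes on B because \<open>p m\<close> does, and T is in the
        span of B; so T pairs \<open>p m\<close> to zero with every form of multidegree E.\<close>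
      fix v assume v: "v \<in> line_bundle_sections k n ?E {}"
      show "segre_eval k n T (v * p m) = 0"
      proof (rule segre_spanD[OF B(3)])
        show "v * p m \<in> line_bundle_sections k n (\<lambda>_. 1) {}"
          by (rule line_bundle_sections_mult'[OF v span_Q[OF p(1)[OF m]] ed])
        fix \<sigma> assume \<sigma>: "\<sigma> \<in> ?I"
        have "p m \<in> twisted_ideal_sections k n B ?F {\<sigma>}"
          using p(2)[OF m] \<sigma> by (intro \<theta>(3)[OF \<sigma> span_Q[OF p(1)[OF m]]]) simp
        from twisted_ideal_sections_mult[OF cl _ _ line_bundle_sections_mono_mem[OF v] this ed]
        show "v * p m \<in> twisted_ideal_sections k n B (\<lambda>_. 1) {\<sigma>}" using \<sigma> by simp
      qed
    qed
  qed
  also have "\<dots> < enat ((\<Prod>i\<in>F. n i + 1) - c)" by (rule assms(11))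
  finally show False
    using Q'(2) \<open>card Q = _\<close> by simp
qed

end
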